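(* Let $P$ be a poset and let $\overrightarrow{\mathbf{S}}=(\mathbf{S}_p,\sigma_p^q\mid p\le q\text{ in }P)$ be a $P$-indexed diagram of $(\vee,0)$-semilattices and $(\vee,0)$-homomorphisms. If either $P$ is finite or there are cardinals $\kappa$ and $\lambda$, with $\lambda$ regular, such that $P$ and all $S_p$, for $p\in P$, have cardinality less than $\lambda$ and the relation $(\kappa,{<}\omega,\lambda)\rightarrow\lambda$ holds, then $\overrightarrow{\mathbf{S}}$ can be lifted, with respect to the $\mathrm{Con_c}$ functor, by some diagram of unary monotone-indexed algebras; that is, there is a $P$-indexed diagram $\overrightarrow{\mathbf{B}}$ in $\mathbf{MAlg}_1$ such that $\mathrm{Con_c}\,\overrightarrow{\mathbf{B}}\cong\overrightarrow{\mathbf{S}}$ (natural isomorphism of $P$-indexed diagrams of $(\vee,0)$-semilattices).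
   Context: All posets are nonempty; a $P$-indexed diagram is a functor from $P$ viewed as a category. A $(\vee,0)$-semilattice is a join-semilattice with least element $0$; $(\vee,0)$-homomorphisms preserve $\vee$ and $0$. $\mathbf{MAlg}_1$ (unary monotone-indexed algebras): objects are all structures $\mathbf{A}$ (with nonempty universe $A$) on arbitrary languages $\mathrm{Lg}(\mathbf{A})$ consisting only of unary operation symbols (no relation or constant symbols). A morphism $\mathbf{A}\to\mathbf{B}$ exists only if $\mathrm{Lg}(\mathbf{A})\subseteq\mathrm{Lg}(\mathbf{B})$, and is then a map $\varphi\colon A\to B$ with $\varphi(f^{\mathbf{A}}(x))=f^{\mathbf{B}}(\varphi(x))$ for all $f\in\mathrm{Lg}(\mathbf{A})$ and $x\in A$. $\mathrm{Con_c}\,\mathbf{A}$ is the $(\vee,0)$-semilattice of compact (= finitely generated) congruences of $\mathbf{A}$. For a morphism $\varphi\colon\mathbf{A}\to\mathbf{B}$, $\mathrm{Con_c}\,\varphi$ sends a compact congruence $\alpha$ to the congruence of $\mathbf{B}$ generated by $\{(\varphi(x),\varphi(y))\mid(x,y)\in\alpha\}$. This defines a functor from $\mathbf{MAlg}_1$ to $(\vee,0)$-semilattices with $(\vee,0)$-homomorphisms. For cardinals $\kappa,\lambda,\rho$, the relation $(\kappa,{<}\omega,\lambda)\rightarrow\rho$ means: for every map $F\colon[\kappa]^{<\omega}\to[\kappa]^{<\lambda}$ there is $H\subseteq\kappa$ with $\mathrm{card}\,H=\rho$ such that $F(Y)\cap H\subseteq Y$ for each finite $Y\subseteq H$. Here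 $[\kappa]^{<\mu}$ denotes the set of subsets of $\kappa$ of cardinality $<\mu$. *)

theory Defs
  imports Main "HOL-Algebra.Lattice"
begin

unbundle cardinal_syntax

section \<open>Join-semilattices with zero and their diagrams\<close>

locale join_semilattice_zero =
  upper_semilattice L + weak_partial_order_bottom L for L (structure)

definition jsz_hom :: "'a gorder \<Rightarrow> 'b gorder \<Rightarrow> ('a \<Rightarrow> 'b) \<Rightarrow> bool" where
  "jsz_hom L M f \<longleftrightarrow>
     f \<in> carrier L \<rightarrow> carrier M \<and>
     (\<forall>x\<in>carrier L. \<forall>y\<in>carrier L. f (x \<squnion>\<^bsub>L\<^esub> y) = f x \<squnion>\<^bsub>M\<^esub> f y) \<and>
     f \<bottom>\<^bsub>L\<^esub> = \<bottom>\<^bsub>M\<^esub>"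

definition jsz_iso :: "'a gorder \<Rightarrow> 'b gorder \<Rightarrow> ('a \<Rightarrow> 'b) \<Rightarrow> bool" where
  "jsz_iso L M f \<longleftrightarrow> jsz_hom L M f \<and> bij_betw f (carrier L) (carrier M)"

text \<open>The transition map from \<open>S p\<close> to \<open>S q\<close> is \<open>s p q\<close>; it is constrained only
  for \<open>p \<le> q\<close> and only on \<open>carrier (S p)\<close>.\<close>

definition jsz_diagram :: "('p::order \<Rightarrow> 'a gorder) \<Rightarrow> ('p \<Rightarrow> 'p \<Rightarrow> 'a \<Rightarrow> 'a) \<Rightarrow> bool" where
  "jsz_diagram S s \<longleftrightarrow>
     (\<forall>p. join_semilattice_zero (S p)) \<and>
     (\<forall>p q. p \<le> q \<longrightarrow> jsz_hom (S p) (S q) (s p q)) \<and>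
     (\<forall>p. \<forall>x\<in>carrier (S p). s p p x = x) \<and>
     (\<forall>p q r. p \<le> q \<and> q \<le> r \<longrightarrow> (\<forall>x\<in>carrier (S p). s q r (s p q x) = s p r x))"

definition jsz_diagram_iso ::
  "('p::order \<Rightarrow> 'a gorder) \<Rightarrow> ('p \<Rightarrow> 'p \<Rightarrow> 'a \<Rightarrow> 'a) \<Rightarrow>
   ('p \<Rightarrow> 'b gorder) \<Rightarrow> ('p \<Rightarrow> 'p \<Rightarrow> 'b \<Rightarrow> 'b) \<Rightarrow> ('p \<Rightarrow> 'a \<Rightarrow> 'b) \<Rightarrow> bool" where
  "jsz_diagram_iso S s T t e \<longleftrightarrow>
     (\<forall>p. jsz_iso (S p) (T p) (e p)) \<and>
     (\<forall>p q. p \<le> q \<longrightarrow> (\<forall>x\<in>carrier (S p). e q (s p q x) = t p q (e p x)))"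

section \<open>Unary monotone-indexed algebras and their diagrams\<close>

record ('f, 'a) unary_algebra =
  lang :: "'f set"
  universe :: "'a set"
  opn :: "'f \<Rightarrow> 'a \<Rightarrow> 'a"

definition is_unary_algebra :: "('f, 'a) unary_algebra \<Rightarrow> bool" where
  "is_unary_algebra A \<longleftrightarrow>
     universe A \<noteq> {} \<and> (\<forall>f\<in>lang A. opn A f \<in> universe A \<rightarrow> universe A)"

definition malg_hom ::
  "('f, 'a) unary_algebra \<Rightarrow> ('f, 'b) unary_algebra \<Rightarrow> ('a \<Rightarrow> 'b) \<Rightarrow> bool" where
  "malg_hom A B h \<longleftrightarrow>
     lang A \<subseteq> lang B \<and>
     h \<in> universe A \<rightarrow> universe B \<and>
     (\<forall>f\<in>lang A. \<forall>x\<in>universe A. h (opn A f x) = opn B f (h x))"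

definition malg_diagram ::
  "('p::order \<Rightarrow> ('f, 'a) unary_algebra) \<Rightarrow> ('p \<Rightarrow> 'p \<Rightarrow> 'a \<Rightarrow> 'a) \<Rightarrow> bool" where
  "malg_diagram B h \<longleftrightarrow>
     (\<forall>p. is_unary_algebra (B p)) \<and>
     (\<forall>p q. p \<le> q \<longrightarrow> malg_hom (B p) (B q) (h p q)) \<and>
     (\<forall>p. \<forall>x\<in>universe (B p). h p p x = x) \<and>
     (\<forall>p q r. p \<le> q \<and> q \<le> r \<longrightarrow> (\<forall>x\<in>universe (B p). h q r (h p q x) = h p r x))"

section \<open>The functor of compact congruences\<close>

definition congruence_of :: "('f, 'a) unary_algebra \<Rightarrow> ('a \<times> 'a) set \<Rightarrow> bool" where
  "congruence_of A \<theta> \<longleftrightarrow>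
     equiv (universe A) \<theta> \<and>
     (\<forall>f\<in>lang A. \<forall>(x, y)\<in>\<theta>. (opn A f x, opn A f y) \<in> \<theta>)"

definition Cg :: "('f, 'a) unary_algebra \<Rightarrow> ('a \<times> 'a) set \<Rightarrow> ('a \<times> 'a) set" where
  "Cg A X = \<Inter>{\<theta>. congruence_of A \<theta> \<and> X \<subseteq> \<theta>}"

definition compact_congruences :: "('f, 'a) unary_algebra \<Rightarrow> ('a \<times> 'a) set set" where
  "compact_congruences A = {Cg A X |X. finite X \<and> X \<subseteq> universe A \<times> universe A}"

definition Conc :: "('f, 'a) unary_algebra \<Rightarrow> ('a \<times> 'a) set gorder" where
  "Conc A = \<lparr>carrier = compact_congruences A, eq = (=), le = (\<subseteq>)\<rparr>"

text \<open>The source algebra is not needed as an argument of the morphism part.\<close>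

definition Conc_map ::
  "('f, 'b) unary_algebra \<Rightarrow> ('a \<Rightarrow> 'b) \<Rightarrow> ('a \<times> 'a) set \<Rightarrow> ('b \<times> 'b) set" where
  "Conc_map B h \<alpha> = Cg B {(h x, h y) |x y. (x, y) \<in> \<alpha>}"

section \<open>The partition relation\<close>

text \<open>\<open>arrow \<kappa> \<mu> \<rho>\<close> is \<open>(\<kappa>, <\<omega>, \<mu>) \<rightarrow> \<rho>\<close>. Cardinals are cardinal orders, and
  \<open>Field \<kappa>\<close> is the underlying set of \<open>\<kappa>\<close>.\<close>

definition arrow :: "'k rel \<Rightarrow> 'l rel \<Rightarrow> 'r rel \<Rightarrow> bool" where
  "arrow \<kappa> \<mu> \<rho> \<longleftrightarrow>
     (\<forall>F. (\<forall>Y. finite Y \<and> Y \<subseteq> Field \<kappa> \<longrightarrow> F Y \<subseteq> Field \<kappa> \<and> |F Y| <o \<mu>) \<longrightarrow>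
        (\<exists>H\<subseteq>Field \<kappa>. |H| =o \<rho> \<and> (\<forall>Y\<subseteq>H. finite Y \<longrightarrow> F Y \<inter> H \<subseteq> Y)))"

section \<open>Ambient types for the lifting\<close>

text \<open>HOL has no existential quantifier over types, so the algebras of a lifting are sought
  inside fixed types. These are large enough for every diagram that has a lifting at all:
  given a lifting, a Loewenheim-Skolem argument (an elementary substructure containing the
  diagram, with the index poset and the semilattices as subsets) yields one whose
  languages and universes have at most \<open>\<aleph>\<^sub>0 + card P + card (\<Union>p. S p)\<close> elements.\<close>

type_synonym ('p, 's) lift_symbol = "(nat + 'p + 's) list"
type_synonym ('p, 's) lift_element = "(nat + 'p + 's) list set"

end

theory Submission
  imports Defs
begin

text \<open>
  A direct construction in the style of Graetzer and Schmidt, functorial in the index, so that no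
  condensate is needed. Each \<open>S p\<close> is realised as the set of values of a distance on a set of
  terms, satisfying the triangle inequality with join in place of addition; every operation is an
  isometry, so \<open>d z w \<le> a\<close> defines a congruence for every \<open>a\<close>. Whenever
  \<open>d u v \<le> d x y\<close>, three operations \<open>f\<^sub>0, f\<^sub>1, f\<^sub>2\<close> are adjoined with
  \<open>f\<^sub>0 x = u\<close>, \<open>f\<^sub>0 y = f\<^sub>1 y\<close>, \<open>f\<^sub>1 x = f\<^sub>2 x\<close> and \<open>f\<^sub>2 y = v\<close>, and are otherwise free;
  this puts \<open>(u, v)\<close> into every congruence containing \<open>(x, y)\<close>, so there are no further
  congruences. Operations are named by the index \<open>q\<close> and the quadruple of terms at \<open>q\<close>
  that they were adjoined for, hence languages and term sets grow with the index and the
  transition maps are induced by inclusions.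
\<close>

section \<open>Terms and their distance\<close>

datatype ('p, 's) tm =
    Base
  | Pt 'p 's
  | Sym 'p "('p, 's) tm" "('p, 's) tm" "('p, 's) tm" "('p, 's) tm"
  | Ap "('p, 's) tm" nat "('p, 's) tm"

text \<open>\<open>Ap (Sym q x y u v) i z\<close> stands for \<open>f\<^sub>i z\<close>, where \<open>f\<^sub>0, f\<^sub>1, f\<^sub>2\<close> are the operations adjoined
  at \<open>q\<close> for \<open>d u v \<le> d x y\<close>. A term \<open>Sym\<close> is only meaningful as such a name.\<close>

primrec lev :: "('p, 's) tm \<Rightarrow> nat" where
  "lev Base = 0"
| "lev (Pt q a) = 1"
| "lev (Sym q x y u v) = Suc (max (max (lev x) (lev y)) (max (lev u) (lev v)))"
| "lev (Ap s i z) = Suc (max (lev s) (lev z))"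

lemma lev_eq_0_iff [simp]: "lev z = 0 \<longleftrightarrow> z = Base"
  by (cases z) auto

fun src1 where "src1 (Sym q x y u v) = x" | "src1 _ = Base"
fun src2 where "src2 (Sym q x y u v) = y" | "src2 _ = Base"
fun tgt1 where "tgt1 (Sym q x y u v) = u" | "tgt1 _ = Base"
fun tgt2 where "tgt2 (Sym q x y u v) = v" | "tgt2 _ = Base"

lemma lev_components:
  "lev (src1 s) \<le> lev s" "lev (src2 s) \<le> lev s" "lev (tgt1 s) \<le> lev s" "lev (tgt2 s) \<le> lev s"
  by (cases s; simp)+

text \<open>The gate of \<open>z\<close> is its nearest term of lower level: \<open>d z w = d z (gate z) \<union> d (gate z) w\<close>
  for every \<open>w\<close> of lower level than \<open>z\<close>.\<close>

fun gate :: "('p, 's) tm \<Rightarrow> ('p, 's) tm" where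
  "gate (Ap s i z) =
     (if lev z \<le> lev s then (if i = 2 then tgt2 s else tgt1 s) else Ap s i (gate z))"
| "gate _ = Base"

text \<open>For an argument no newer than the symbol, the gate is a component of the symbol and
  hence older than every value of the operation. For a newer argument the level is governed by
  \<open>z\<close>, and the induction hypothesis lowers it.\<close>

lemma lev_gate: "z \<noteq> Base \<Longrightarrow> lev (gate z) < lev z"
proof (induction z)
  case (Ap s i z)
  then show ?case
    using lev_components[of s] by (cases "z = Base") (auto simp: le_imp_less_Suc)
qed auto

lemma lev_gate_less: "lev w < lev z \<Longrightarrow> lev (gate z) < lev z"
  by (rule lev_gate) auto

lemma lev_gate_eq:
  assumes "lev w = lev z" "z \<noteq> w"
  shows "lev (gate z) < lev z \<and> lev (gate w) < lev z"
  using assms lev_eq_0_iff lev_gate by metis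

lemma lev_Ap_less:
  "lev z < lev (Ap s i z)" "lev (src1 s) < lev (Ap s i z)" "lev (src2 s) < lev (Ap s i z)"
  using lev_components[of s] by (simp_all add: less_Suc_eq_le max_def)

lemma max_less_max:
  fixes a b c d :: nat
  shows "a < c \<Longrightarrow> b < d \<Longrightarrow> max a b < max c d"
    and "a < c \<Longrightarrow> b < c \<Longrightarrow> Suc (2 * max a b) < 2 * c"
  by auto

section \<open>Copies of old terms and the points where they are glued\<close>

fun body where "body (Ap s i z) = z" | "body z = z"

fun same_copy :: "('p, 's) tm \<Rightarrow> ('p, 's) tm \<Rightarrow> bool" where
  "same_copy (Ap s i z) (Ap t j w) \<longleftrightarrow> s = t \<and> i = j"
| "same_copy _ _ \<longleftrightarrow> False"

text \<open>Copies 0 and 1 share the image of \<open>y\<close>, copies 1 and 2 that of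
  \<open>x\<close>; copies 0 and 2 communicate only through their gates \<open>u\<close> and
  \<open>v\<close>. The level tests select arguments that existed when the operations were adjoined;
  values at newer arguments in different copies are joined through gates.\<close>

fun hinge :: "('p, 's) tm \<Rightarrow> ('p, 's) tm \<Rightarrow> ('p, 's) tm option" where
  "hinge (Ap s i z) (Ap t j w) =
    (if s = t \<and> lev z \<le> lev s \<and> lev w \<le> lev s then
       if i = 0 \<and> j = 1 \<or> i = 1 \<and> j = 0 then Some (src2 s)
       else if i = 1 \<and> j = 2 \<or> i = 2 \<and> j = 1 then Some (src1 s)
       else None
     else None)"
| "hinge _ _ = None"

lemma same_copyE:
  assumes "same_copy z w"
  obtains s i z' w' where "z = Ap s i z'" "w = Ap s i w'"
  using assms by (cases z; cases w) auto

lemma hingeE: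
  assumes "hinge z w = Some c"
  obtains s i j z' w' where "z = Ap s i z'" "w = Ap s j w'" "lev z' \<le> lev s" "lev w' \<le> lev s"
    "i = 0 \<and> j = 1 \<and> c = src2 s \<or> i = 1 \<and> j = 0 \<and> c = src2 s \<or>
     i = 1 \<and> j = 2 \<and> c = src1 s \<or> i = 2 \<and> j = 1 \<and> c = src1 s"
  using assms by (cases z; cases w) (auto split: if_splits)

lemma lev_same_copy:
  assumes "same_copy z w"
  shows "lev (body z) < lev z \<and> lev (body w) < lev w"
  using assms by (rule same_copyE) (simp add: less_Suc_eq_le)

lemma lev_hinge:
  assumes "hinge z w = Some c"
  shows "lev (body z) < lev z \<and> lev (body w) < lev w \<and> lev c < lev z \<and> lev c < lev w"
  using assms
proof (rule hingeE)
  fix s i j z' w'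
  assume "z = Ap s i z'" "w = Ap s j w'" 
    and "i = 0 \<and> j = 1 \<and> c = src2 s \<or> i = 1 \<and> j = 0 \<and> c = src2 s \<or>
     i = 1 \<and> j = 2 \<and> c = src1 s \<or> i = 2 \<and> j = 1 \<and> c = src1 s"
  moreover from this have "c = src1 s \<or> c = src2 s" by blast
  ultimately show ?thesis using lev_Ap_less by (metis body.simps(1))
qed

text \<open>Distances are sets, with union as join. \<open>lbl l z\<close> is the distance from \<open>z\<close> to its gate.
  Two terms \<open>f\<^sub>i z\<close>, \<open>f\<^sub>j w\<close> of the same level are joined through the point common to the two
  copies if \<open>\<bar>i - j\<bar> = 1\<close>; distinct copies are otherwise joined through their gates.\<close>

function dst :: "('p \<Rightarrow> 's \<Rightarrow> 'v set) \<Rightarrow> ('p, 's) tm \<Rightarrow> ('p, 's) tm \<Rightarrow> 'v set"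
  and lbl :: "('p \<Rightarrow> 's \<Rightarrow> 'v set) \<Rightarrow> ('p, 's) tm \<Rightarrow> 'v set"
  where
  "dst l z w =
    (if lev w < lev z then lbl l z \<union> dst l (gate z) w
     else if lev z < lev w then lbl l w \<union> dst l z (gate w)
     else if z = w then {}
     else if same_copy z w then dst l (body z) (body w)
     else (case hinge z w of
       Some c \<Rightarrow> dst l (body z) c \<union> dst l c (body w)
     | None \<Rightarrow> lbl l z \<union> dst l (gate z) (gate w) \<union> lbl l w))"
| "lbl l Base = {}"
| "lbl l (Pt q a) = l q a"
| "lbl l (Sym q x y u v) = {}"
| "lbl l (Ap s i z) =
    (if lev z \<le> lev s then
       (if i = 0 then dst l z (src1 s)
        else if i = 1 then dst l z (src1 s) \<union> dst l (src1 s) (src2 s)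
        else dst l z (src2 s))
     else lbl l z)"
  by pat_completeness
    (simp_all only: sum.inject sum.distinct prod.inject tm.inject tm.distinct simp_thms)
termination
  \<comment> \<open>\<open>dst\<close> calls \<open>lbl\<close> at most at its own maximal level,
    while \<open>lbl\<close> calls \<open>dst\<close> only at strictly lower levels. The odd and
    even weights rank the two functions at equal level.\<close>
  by (relation "measure (\<lambda>x. case x of Inl (l, z, w) \<Rightarrow> Suc (2 * max (lev z) (lev w))
      | Inr (l, z) \<Rightarrow> 2 * lev z)";
    (auto simp: lev_Ap_less max_less_max lev_gate_less simp del: lev.simps
      dest: lev_same_copy lev_hinge)?;
    (drule (1) lev_gate_eq)?; simp)

declare dst.simps [simp del]

section \<open>The triangle inequality\<close>

lemma dst_refl [simp]: "dst l z z = {}"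
  by (simp add: dst.simps[of l z z])

lemma dst_high: "lev w < lev z \<Longrightarrow> dst l z w = lbl l z \<union> dst l (gate z) w"
  by (simp add: dst.simps[of l z w])

lemma dst_high': "lev z < lev w \<Longrightarrow> dst l z w = lbl l w \<union> dst l z (gate w)"
  by (simp add: dst.simps[of l z w])

lemma dst_same_copy:
  assumes "lev z = lev w" "same_copy z w"
  shows "dst l z w = dst l (body z) (body w)"
  using assms by (cases "z = w") (simp_all add: dst.simps[of l z w])

lemma dst_hinge:
  assumes "lev z = lev w" "hinge z w = Some c"
  shows "dst l z w = dst l (body z) c \<union> dst l c (body w)"
proof -
  have "\<not> same_copy z w" "z \<noteq> w"
    using assms(2) by (rule hingeE, auto)+
  then show ?thesis
    using assms by (simp add: dst.simps[of l z w])
qed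

lemma dst_generic:
  assumes "lev z = lev w" "z \<noteq> w" "\<not> same_copy z w" "hinge z w = None"
  shows "dst l z w = lbl l z \<union> dst l (gate z) (gate w) \<union> lbl l w"
  using assms by (simp add: dst.simps[of l z w])

text \<open>In the middle copy the way to the gate \<open>u\<close> crosses copy 0 from
  \<open>y\<close> to \<open>x\<close>, whence the summand \<open>dst l (src1 s) (src2 s)\<close> of
  its label; \<open>v\<close> is equally far once
  \<open>dst l u v \<subseteq> dst l x y\<close>.\<close>

lemma dst_gate: "dst l z (gate z) = lbl l z"
proof (cases "z = Base")
  case False
  then show ?thesis
    using lev_gate[of z] by (simp add: dst_high)
qed simp

section \<open>Symmetry of the distance and isometry of the operations\<close>

lemma same_copy_commute: "same_copy z w = same_copy w z"
  by (cases z; cases w) auto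

lemma hinge_commute: "hinge z w = hinge w z"
  by (cases z; cases w) auto

lemma dst_commute: "dst l z w = dst l w z"
proof (induction "max (lev z) (lev w)" arbitrary: z w rule: less_induct)
  case less
  consider "lev w < lev z" | "lev z < lev w" | "z = w" | "lev z = lev w" "z \<noteq> w"
    by force
  then show ?case
  proof cases
    case 1
    then have "dst l (gate z) w = dst l w (gate z)"
      using less lev_gate_less[OF 1] by simp
    with 1 show ?thesis by (simp add: dst_high dst_high')
  next
    case 2
    then have "dst l z (gate w) = dst l (gate w) z"
      using less lev_gate_less[OF 2] by simp
    with 2 show ?thesis by (simp add: dst_high dst_high')
  next
    case 3
    then show ?thesis by simp
  next
    case 4
    note gates = lev_gate_eq[OF 4(1)[symmetric] 4(2)]
    show ?thesis
    proof (cases "same_copy z w")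
      case True
      then have "dst l (body z) (body w) = dst l (body w) (body z)"
        using lev_same_copy[OF True] by (intro less) auto
      with True 4 show ?thesis by (simp add: dst_same_copy same_copy_commute)
    next
      case no_copy: False
      show ?thesis
      proof (cases "hinge z w")
        case None
        have "dst l (gate z) (gate w) = dst l (gate w) (gate z)"
          using less gates 4 by simp
        with None no_copy 4 show ?thesis
          using dst_generic[of z w l] dst_generic[of w z l] same_copy_commute[of z w]
            hinge_commute[of z w] by auto
      next
        case (Some c)
        then have "dst l (body z) c = dst l c (body z)" "dst l (body w) c = dst l c (body w)"
          using lev_hinge[OF Some] by (auto intro!: less)
        with Some 4 show ?thesis
          using dst_hinge[of z w c l] dst_hinge[of w z c l] hinge_commute[of z w] by auto
      qed
    qed
  qed
qed

text \<open>For \<open>lev s < lev z\<close> the gate of \<open>Ap s i z\<close> is the image of the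
  gate of \<open>z\<close> and the label is unchanged, so both recursions run in parallel. Images of
  equal level lie in one copy, where the equation is immediate.\<close>

lemma dst_Ap_Ap [simp]: "dst l (Ap s i z) (Ap s i w) = dst l z w"
proof -
  have old: "dst l (Ap s i z) (Ap s i w) = dst l z w"
    if "dst l (Ap s i (gate z)) (Ap s i w) = dst l (gate z) w"
      "lev w < lev z" "lev s < lev z" for z w
    using that by (simp add: dst_high)
  have same: "dst l (Ap s i z) (Ap s i w) = dst l z w"
    if "max (lev s) (lev z) = max (lev s) (lev w)" for z w
    using that by (simp add: dst_same_copy)
  show ?thesis
  proof (induction "lev z + lev w" arbitrary: z w rule: less_induct)
    case less
    have "max (lev s) (lev z) = max (lev s) (lev w) \<or>
        lev w < lev z \<and> lev s < lev z \<or> lev z < lev w \<and> lev s < lev w"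
      by arith
    then consider "max (lev s) (lev z) = max (lev s) (lev w)"
      | "lev w < lev z" "lev s < lev z" | "lev z < lev w" "lev s < lev w"
      by blast
    then show ?case
    proof cases
      case 1
      then show ?thesis by (rule same)
    next
      case 2
      then show ?thesis
        by (intro old[OF less]) (simp_all add: lev_gate_less)
    next
      case 3
      have "dst l (Ap s i w) (Ap s i z) = dst l w z"
        using 3 by (intro old[OF less]) (simp_all add: lev_gate_less)
      then show ?thesis by (simp add: dst_commute)
    qed
  qed
qed

text \<open>\<open>V\<close> abstracts the terms valid at one index. The inclusion in
  \<open>Ap_inD\<close> ensures that the chain from \<open>u\<close> to \<open>v\<close> through the
  three copies, of total length \<open>dst l x y\<close>, does not undercut
  \<open>dst l u v\<close>. \<open>Ap_in\<close> keeps gates inside \<open>V\<close>.\<close>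

locale term_space =
  fixes l :: "'p \<Rightarrow> 's \<Rightarrow> 'v set" and V :: "('p, 's) tm set"
  assumes Base_in: "Base \<in> V"
    and Ap_inD: "Ap s i z \<in> V \<Longrightarrow> z \<in> V \<and> i < 3 \<and>
      (\<exists>q x y u v. s = Sym q x y u v \<and> x \<in> V \<and> y \<in> V \<and> u \<in> V \<and> v \<in> V \<and>
        dst l u v \<subseteq> dst l x y)"
    and Ap_in: "Ap s i z \<in> V \<Longrightarrow> j < 3 \<Longrightarrow> w \<in> V \<Longrightarrow> Ap s j w \<in> V"
begin

lemma gate_in: "z \<in> V \<Longrightarrow> gate z \<in> V"
proof (induction z)
  case (Ap s i z)
  then show ?case
    using Ap_inD[OF Ap.prems] Ap_in[OF Ap.prems] by auto
qed (auto simp: Base_in)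

text \<open>The triangle inequality for two terms of level \<open>k\<close> and their gates, given
  it below \<open>k\<close>. The lower bound is the triangle on \<open>z\<close>, \<open>w\<close>,
  \<open>gate w\<close>, since \<open>lbl l z \<union> dst l (gate z) (gate w)\<close> is the
  distance from \<open>z\<close> to \<open>gate w\<close>.\<close>

lemma
  assumes IH: "\<And>a b c. \<lbrakk>a \<in> V; b \<in> V; c \<in> V; lev a < k; lev b < k; lev c < k\<rbrakk>
      \<Longrightarrow> dst l a c \<subseteq> dst l a b \<union> dst l b c"
    and z: "z \<in> V" "lev z = k" and w: "w \<in> V" "lev w = k"
  shows gate_upper: "dst l z w \<subseteq> lbl l z \<union> dst l (gate z) (gate w) \<union> lbl l w"
    and gate_lower: "lbl l z \<union> dst l (gate z) (gate w) \<subseteq> dst l z w \<union> lbl l w"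
proof -
  let ?A = "dst l z w \<subseteq> lbl l z \<union> dst l (gate z) (gate w) \<union> lbl l w"
  let ?B = "lbl l z \<union> dst l (gate z) (gate w) \<subseteq> dst l z w \<union> lbl l w"
  have lev_eq: "lev z = lev w" using z w by simp
  have "?A \<and> ?B"
  proof (cases "z = w")
    case True
    then show ?thesis by simp
  next
    case neq: False
    show ?thesis
    proof (cases "same_copy z w")
      case True
      then obtain s i a b where zw: "z = Ap s i a" "w = Ap s i b"
        by (rule same_copyE)
      with z w Ap_inD obtain q x y u v where s: "s = Sym q x y u v"
        and V: "a \<in> V" "b \<in> V" "x \<in> V" "y \<in> V"
        by meson
      have "lev a < lev z" "lev b < lev w" "lev x < lev z" "lev y < lev z"
        by (simp_all add: zw s less_Suc_eq_le)
      then have lt: "lev a < k" "lev b < k" "lev x < k" "lev y < k"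
        using z(2) w(2) by simp_all
      \<comment> \<open>For old arguments the gates coincide and the labels are made of distances to
        \<open>x\<close> and \<open>y\<close>. For newer ones the isometry reduces both claims to
        the triangle on \<open>a\<close>, \<open>b\<close>, \<open>gate b\<close>.\<close>
      show ?thesis
      proof (cases "lev a \<le> lev s")
        case True
        then have old: "lev b \<le> lev s"
          using lev_eq zw by (auto simp: max_def split: if_splits)
        have "dst l a b \<subseteq> dst l a c \<union> dst l b c" "dst l a c \<subseteq> dst l a b \<union> dst l b c"
          if "c = x \<or> c = y" for c
          using that IH[of a c b] IH[of a b c] V lt by (auto simp: dst_commute[of l c b])
        then show ?thesis
          using True old by (simp add: zw s) blast
      next
        case False
        then have lev_ab: "lev a = lev b" "\<not> lev b \<le> lev s"
          using lev_eq zw by (auto simp: max_def split: if_splits)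
        then have nonbase: "a \<noteq> Base" "b \<noteq> Base" by auto
        have g: "gate a \<in> V" "gate b \<in> V" "lev (gate a) < lev a" "lev (gate b) < lev a"
          using gate_in V lev_gate[of a] lev_gate[of b] nonbase lev_ab by auto
        have "lbl l a \<union> dst l (gate a) (gate b) = dst l a (gate b)"
          using g by (simp add: dst_high)
        moreover have "dst l a (gate b) \<subseteq> dst l a b \<union> lbl l b"
          using IH[of a b "gate b"] V g lt by (simp add: dst_gate)
        moreover have "dst l a b \<subseteq> dst l a (gate b) \<union> lbl l b"
          using IH[of a "gate b" b] V g lt by (simp add: dst_gate dst_commute[of l "gate b" b])
        ultimately show ?thesis
          using False lev_ab by (simp add: zw)
      qed
    next
      case no_copy: False
      show ?thesis
      proof (cases "hinge z w")
        case None
        then show ?thesis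
          using dst_generic[OF lev_eq neq no_copy, of l] by auto
      next
        case (Some c)
        then obtain s i j a b where zw: "z = Ap s i a" "w = Ap s j b"
          and lev_s: "lev a \<le> lev s" "lev b \<le> lev s"
          and ij: "i = 0 \<and> j = 1 \<and> c = src2 s \<or> i = 1 \<and> j = 0 \<and> c = src2 s \<or>
            i = 1 \<and> j = 2 \<and> c = src1 s \<or> i = 2 \<and> j = 1 \<and> c = src1 s"
          by (rule hingeE)
        with z w Ap_inD obtain q x y u v where s: "s = Sym q x y u v"
          and V: "a \<in> V" "b \<in> V" "x \<in> V" "y \<in> V" and uv: "dst l u v \<subseteq> dst l x y"
          by meson
        have "lev a < lev z" "lev b < lev w" "lev x < lev z" "lev y < lev z"
          by (simp_all add: zw s less_Suc_eq_le)
        then have lt: "lev a < k" "lev b < k" "lev x < k" "lev y < k"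
          using z(2) w(2) by simp_all
        have sides: "dst l x y \<subseteq> dst l e x \<union> dst l e y" "dst l e x \<subseteq> dst l e y \<union> dst l x y"
            "dst l e y \<subseteq> dst l e x \<union> dst l x y"
          if "e = a \<or> e = b" for e
          using that IH[of x e y] IH[of e y x] IH[of e x y] V lt
          by (auto simp: dst_commute[of l x e] dst_commute[of l y x])
        have E: "dst l z w = dst l a c \<union> dst l b c"
          using dst_hinge[OF lev_eq Some, of l] by (simp add: zw dst_commute[of l c])
        \<comment> \<open>If copy 2 is involved, the gates are \<open>u\<close> and
          \<open>v\<close>; their distance is absorbed by \<open>dst l x y\<close>, and this in turn
          by the two distances from a body to \<open>x\<close> and \<open>y\<close>.\<close>
        note T = sides[OF disjI1, OF refl] sides[OF disjI2, OF refl] uv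
        from ij show ?thesis
          unfolding E
        proof (elim disjE conjE, goal_cases)
          case 1
          then show ?case using T lev_s by (simp add: zw s) blast
        next
          case 2
          then show ?case using T lev_s by (simp add: zw s) blast
        next
          case 3
          then show ?case using T lev_s by (simp add: zw s) blast
        next
          case 4
          then show ?case using T lev_s by (simp add: zw s dst_commute[of l v u]) blast
        qed
      qed
    qed
  qed
  then show ?A ?B by blast+
qed

text \<open>Here all three terms lie in copies belonging to a single symbol, so everything reduces
  to triangles among the bodies and \<open>x\<close>, \<open>y\<close>, which have lower
  level.\<close>

lemma same_block_chain:
  assumes IH: "\<And>a b c. \<lbrakk>a \<in> V; b \<in> V; c \<in> V; lev a < k; lev b < k; lev c < k\<rbrakk>
      \<Longrightarrow> dst l a c \<subseteq> dst l a b \<union> dst l b c"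
    and lev: "lev z1 = k" "lev z2 = k" "lev z3 = k"
    and V: "z1 \<in> V" "z2 \<in> V" "z3 \<in> V"
    and near: "same_copy z1 z2 \<or> hinge z1 z2 \<noteq> None" "same_copy z2 z3 \<or> hinge z2 z3 \<noteq> None"
  shows "dst l z1 z3 \<subseteq> dst l z1 z2 \<union> dst l z2 z3"
proof -
  have blockE: "\<exists>s i j a b. z = Ap s i a \<and> w = Ap s j b \<and>
      (i = j \<or> lev a \<le> lev s \<and> lev b \<le> lev s \<and>
        (i = 0 \<and> j = 1 \<or> i = 1 \<and> j = 0 \<or> i = 1 \<and> j = 2 \<or> i = 2 \<and> j = 1))"
    if "same_copy z w \<or> hinge z w \<noteq> None" for z w
    using that by (elim disjE) (blast elim: same_copyE, force elim: hingeE)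
  obtain s i j a b where z12: "z1 = Ap s i a" "z2 = Ap s j b"
    and ij: "i = j \<or> lev a \<le> lev s \<and> lev b \<le> lev s \<and>
        (i = 0 \<and> j = 1 \<or> i = 1 \<and> j = 0 \<or> i = 1 \<and> j = 2 \<or> i = 2 \<and> j = 1)"
    using blockE[OF near(1)] by blast
  obtain m c where z3: "z3 = Ap s m c"
    and jm: "j = m \<or> lev b \<le> lev s \<and> lev c \<le> lev s \<and>
        (j = 0 \<and> m = 1 \<or> j = 1 \<and> m = 0 \<or> j = 1 \<and> m = 2 \<or> j = 2 \<and> m = 1)"
    using blockE[OF near(2)] z12 by auto
  obtain q x y u v where s: "s = Sym q x y u v"
    and xyV: "x \<in> V" "y \<in> V" and uv: "dst l u v \<subseteq> dst l x y"
    using Ap_inD V(1) z12(1) by meson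
  have abcV: "a \<in> V" "b \<in> V" "c \<in> V"
    using Ap_inD V z12 z3 by blast+
  have "lev a < lev z1" "lev b < lev z2" "lev c < lev z3" "lev x < lev z1" "lev y < lev z1"
    by (simp_all add: z12 z3 s less_Suc_eq_le)
  then have lt: "lev a < k" "lev b < k" "lev c < k" "lev x < k" "lev y < k"
    by (simp_all only: lev)
  have tri: "dst l e g \<subseteq> dst l e f \<union> dst l f g"
    if "e \<in> {a, b, c, x, y}" "f \<in> {a, b, c, x, y}" "g \<in> {a, b, c, x, y}" for e f g
    using that abcV xyV lt by (intro IH) auto
  show ?thesis
  proof (cases "i = j \<and> j = m")
    case True
    then show ?thesis using tri[of a b c] by (simp add: z12 z3)
  next
    case False
    have lev_eq: "max (lev s) (lev a) = max (lev s) (lev b)" "max (lev s) (lev b) = max (lev s) (lev c)"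
      using lev by (simp_all add: z12 z3)
    \<comment> \<open>Two different copies occur, hence a hinge; equal levels then make the third
      body old as well.\<close>
    with False ij jm have fresh: "lev a \<le> lev s" "lev b \<le> lev s" "lev c \<le> lev s"
      by (auto simp: max_def split: if_splits)
    have hinges: "dst l (Ap s 0 e) (Ap s 1 f) = dst l e y \<union> dst l y f"
      "dst l (Ap s 1 e) (Ap s 0 f) = dst l e y \<union> dst l y f"
      "dst l (Ap s 1 e) (Ap s 2 f) = dst l e x \<union> dst l x f"
      "dst l (Ap s 2 e) (Ap s 1 f) = dst l e x \<union> dst l x f"
      if "lev e \<le> lev s" "lev f \<le> lev s" for e f
      using that dst_hinge[of "Ap s 0 e" "Ap s 1 f" y l] dst_hinge[of "Ap s 1 e" "Ap s 0 f" y l]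
        dst_hinge[of "Ap s 1 e" "Ap s 2 f" x l] dst_hinge[of "Ap s 2 e" "Ap s 1 f" x l]
      by (simp_all add: max_absorb1 s)
    note hs = hinges[OF fresh(1,2)] hinges[OF fresh(2,3)] hinges[OF fresh(1,3)]
    have far: "dst l z1 z3 \<subseteq> lbl l z1 \<union> dst l (gate z1) (gate z3) \<union> lbl l z3"
      by (rule gate_upper[of k, OF IH]) (use lev V in auto)
    note T = tri[of a x c] tri[of a y c] tri[of a b x] tri[of a b y] tri[of x b c] tri[of y b c]
    consider "i = 0 \<and> j = 1 \<and> m = 2" | "i = 2 \<and> j = 1 \<and> m = 0"
      | "i = m \<and> (i = 0 \<or> i = 2) \<and> j = 1 \<or> i = m \<and> i = 1 \<and> (j = 0 \<or> j = 2)"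
      | "i = j \<and> (j = 0 \<and> m = 1 \<or> j = 1 \<and> m = 0 \<or> j = 1 \<and> m = 2 \<or> j = 2 \<and> m = 1)"
      | "(i = 0 \<and> j = 1 \<or> i = 1 \<and> j = 0 \<or> i = 1 \<and> j = 2 \<or> i = 2 \<and> j = 1) \<and> j = m"
      using False ij jm by (elim disjE conjE; simp)
    then show ?thesis
    proof cases
      case 1
      \<comment> \<open>Going from copy 0 to copy 2 passes the hinges \<open>y\<close> and
        \<open>x\<close>. The legs from \<open>b\<close> to them cover \<open>dst l x y\<close> and
        hence the distance \<open>dst l u v\<close> of the gates.\<close>
      then have "dst l z1 z3 \<subseteq> dst l a x \<union> dst l u v \<union> dst l c y"
        using far fresh by (simp add: z12 z3 s)
      moreover have "dst l a x \<subseteq> dst l a y \<union> dst l x y" "dst l x y \<subseteq> dst l x b \<union> dst l y b"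
        "dst l c y \<subseteq> dst l x c \<union> dst l x y"
        using tri[of a y x] tri[of x b y] tri[of c x y]
        by (simp_all add: dst_commute[of l y x] dst_commute[of l b y] dst_commute[of l c x])
      moreover have "dst l z1 z2 = dst l a y \<union> dst l y b" "dst l z2 z3 = dst l b x \<union> dst l x c"
        using hs 1 by (simp_all add: z12 z3)
      ultimately show ?thesis using uv by (simp add: dst_commute[of l b x]) blast
    next
      case 2
      then have "dst l z1 z3 \<subseteq> dst l a y \<union> dst l u v \<union> dst l c x"
        using far fresh by (simp add: z12 z3 s dst_commute[of l v u])
      moreover have "dst l a y \<subseteq> dst l a x \<union> dst l x y" "dst l x y \<subseteq> dst l x b \<union> dst l y b"
        "dst l c x \<subseteq> dst l y c \<union> dst l x y"
        using tri[of a x y] tri[of x b y] tri[of c y x]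
        by (simp_all add: dst_commute[of l y x] dst_commute[of l b y] dst_commute[of l c y])
      moreover have "dst l z1 z2 = dst l a x \<union> dst l x b" "dst l z2 z3 = dst l b y \<union> dst l y c"
        using hs 2 by (simp_all add: z12 z3)
      ultimately show ?thesis using uv by (simp add: dst_commute[of l b y]) blast
    next
      case 3
      then show ?thesis
        using hs T by (elim disjE conjE; simp add: z12 z3 dst_commute[of l b]; blast)
    next
      case 4
      then show ?thesis
        using hs T by (elim disjE conjE; simp add: z12 z3; blast)
    next
      case 5
      have "dst l x c \<subseteq> dst l x b \<union> dst l b c" "dst l y c \<subseteq> dst l y b \<union> dst l b c"
        using tri by simp_all
      with 5 show ?thesis
        by (elim disjE conjE; simp add: z12 z3 hs del: One_nat_def; blast)
    qed
  qed
qed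

text \<open>Induction on a strict bound for the levels, by the number of terms on the top level. Top
  terms are traded for their gates, except when all three are on top and consecutive ones share a
  copy or a hinge.\<close>

lemma triangle:
  assumes "z \<in> V" "w \<in> V" "y \<in> V"
  shows "dst l z y \<subseteq> dst l z w \<union> dst l w y"
proof -
  have "dst l z y \<subseteq> dst l z w \<union> dst l w y"
    if "z \<in> V" "w \<in> V" "y \<in> V" "lev z < k" "lev w < k" "lev y < k" for k z w y
    using that
  proof (induction k arbitrary: z w y)
    case (Suc k)
    note IH = Suc.IH
    note V = Suc.prems(1-3)
    have g: "gate a \<in> V" "lev (gate a) < k" if "a \<in> V" "lev a = k" "b \<in> V" "lev b < k" for a b
      using that gate_in lev_gate_less[of b a] by auto
    have ge: "gate a \<in> V" "gate b \<in> V" "lev (gate a) < k" "lev (gate b) < k"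
      if "a \<in> V" "lev a = k" "b \<in> V" "lev b = k" "a \<noteq> b" for a b
      using that gate_in lev_gate_eq[of b a] by auto
    have one: "dst l a c \<subseteq> dst l a b \<union> dst l b c" "dst l b c \<subseteq> dst l a b \<union> dst l a c"
      if "a \<in> V" "lev a = k" "b \<in> V" "lev b < k" "c \<in> V" "lev c < k" for a b c
    proof -
      note ga = g[OF that(1-4)]
      have "dst l (gate a) c \<subseteq> dst l (gate a) b \<union> dst l b c"
        "dst l b c \<subseteq> dst l (gate a) b \<union> dst l (gate a) c"
        using IH[of "gate a" b c] IH[of b "gate a" c] ga that
        by (simp_all add: dst_commute[of l b "gate a"])
      then show "dst l a c \<subseteq> dst l a b \<union> dst l b c" "dst l b c \<subseteq> dst l a b \<union> dst l a c"
        using that by (auto simp: dst_high)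
    qed
    have two: "dst l a b \<subseteq> dst l a c \<union> dst l b c" "dst l a c \<subseteq> dst l a b \<union> dst l b c"
      if ab: "a \<in> V" "lev a = k" "b \<in> V" "lev b = k" and c: "c \<in> V" "lev c < k" for a b c
    proof -
      note gab = g[OF ab(1,2) c] g[OF ab(3,4) c]
      have "dst l (gate a) (gate b) \<subseteq> dst l (gate a) c \<union> dst l (gate b) c"
        "dst l (gate a) c \<subseteq> dst l (gate a) (gate b) \<union> dst l (gate b) c"
        using IH[of "gate a" c "gate b"] IH[of "gate a" "gate b" c] gab c
        by (simp_all add: dst_commute[of l c])
      moreover note gate_upper[of k a b, OF IH ab] gate_lower[of k a b, OF IH ab]
      ultimately show "dst l a b \<subseteq> dst l a c \<union> dst l b c" "dst l a c \<subseteq> dst l a b \<union> dst l b c"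
        using ab c by (auto simp: dst_high)
    qed
    \<comment> \<open>Since \<open>a\<close> and \<open>b\<close> are joined through their gates,
      \<open>lbl l b\<close> is part of \<open>dst l a b\<close>; this pays for the
      \<open>lbl l b\<close> in the lower bound for \<open>c\<close> and \<open>b\<close>.\<close>
    have three: "dst l a c \<subseteq> dst l a b \<union> dst l b c"
      if lev: "lev a = k" "lev b = k" "lev c = k" and V: "a \<in> V" "b \<in> V" "c \<in> V"
        and dist: "a \<noteq> b" "b \<noteq> c" "a \<noteq> c"
        and far: "\<not> same_copy a b \<and> hinge a b = None" for a b c
    proof -
      have "dst l a b = lbl l a \<union> dst l (gate a) (gate b) \<union> lbl l b"
        using far lev dist by (intro dst_generic) auto
      moreover have "lbl l c \<union> dst l (gate c) (gate b) \<subseteq> dst l c b \<union> lbl l b"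
        by (rule gate_lower[of k c b, OF IH]) (use V lev in auto)
      moreover have "dst l a c \<subseteq> lbl l a \<union> dst l (gate a) (gate c) \<union> lbl l c"
        by (rule gate_upper[of k a c, OF IH]) (use V lev in auto)
      moreover have "dst l (gate a) (gate c) \<subseteq> dst l (gate a) (gate b) \<union> dst l (gate c) (gate b)"
        using IH[of "gate a" "gate b" "gate c"] ge[of a b] ge[of b c] V lev dist
        by (simp add: dst_commute[of l "gate b" "gate c"])
      ultimately show ?thesis
        by (simp add: dst_commute[of l b c]) blast
    qed
    consider "lev z < k" "lev w < k" "lev y < k"
      | "lev z = k" "lev w < k" "lev y < k" | "lev z < k" "lev w = k" "lev y < k"
      | "lev z < k" "lev w < k" "lev y = k" | "lev z = k" "lev w = k" "lev y < k"
      | "lev z = k" "lev w < k" "lev y = k" | "lev z < k" "lev w = k" "lev y = k"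
      | "lev z = k" "lev w = k" "lev y = k"
      using Suc.prems(4-6) by (auto simp: less_Suc_eq)
    then show ?case
    proof cases
      case 1
      with V show ?thesis by (intro IH)
    next
      case 2
      with V show ?thesis by (intro one)
    next
      case 3
      with V one(2)[of w z y] show ?thesis by (simp add: dst_commute[of l z w])
    next
      case 4
      with V one(1)[of y w z] show ?thesis by (simp add: dst_commute[of l y] dst_commute[of l w z] Un_commute)
    next
      case 5
      with V show ?thesis by (intro two)
    next
      case 6
      with V two(1)[of z y w] show ?thesis by (simp add: dst_commute[of l y w])
    next
      case 7
      with V two(2)[of y w z] show ?thesis by (simp add: dst_commute[of l y] dst_commute[of l w z] Un_commute)
    next
      case lev: 8
      show ?thesis
      proof (cases "z = w \<or> w = y \<or> z = y")
        case True
        then show ?thesis by auto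
      next
        case neq: False
        consider "\<not> same_copy z w \<and> hinge z w = None" | "\<not> same_copy w y \<and> hinge w y = None"
          | "same_copy z w \<or> hinge z w \<noteq> None" "same_copy w y \<or> hinge w y \<noteq> None"
          by blast
        then show ?thesis
        proof cases
          case 1
          show ?thesis by (rule three) (use 1 neq lev V in auto)
        next
          case 2
          have "dst l y z \<subseteq> dst l y w \<union> dst l w z"
            by (rule three) (use 2 neq lev V same_copy_commute[of y w] hinge_commute[of y w] in auto)
          then show ?thesis by (simp add: dst_commute[of l y] dst_commute[of l w z] Un_commute)
        next
          case 3
          show ?thesis by (rule same_block_chain[OF IH]) (use 3 lev V in auto)
        qed
      qed
    qed
  qed simp
  from this[of z w y "Suc (max (lev z) (max (lev w) (lev y)))"] show ?thesis
    using assms by (simp add: less_Suc_eq_le)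
qed

end

section \<open>The distances along a diagram of semilattices\<close>

text \<open>The recursion pattern depends on the terms alone. Discarding the label function from the
  induction predicates makes one induction serve two label functions with different values.\<close>

lemmas gate_induct =
  dst_lbl.induct[of "\<lambda>(_ :: 'p \<Rightarrow> 's \<Rightarrow> unit set). P" "\<lambda>_. Q" for P Q]

text \<open>A distance is a finite union of labels of points, selected by a recursion that inspects
  only the terms. A relation respecting the empty set and unions therefore passes from labels to
  distances; \<open>W\<close> confines the recursion to terms with controlled labels.\<close>

lemma dst_related:
  assumes empty: "({}, {}) \<in> R"
    and un: "\<And>A B A' B'. (A, B) \<in> R \<Longrightarrow> (A', B') \<in> R \<Longrightarrow> (A \<union> A', B \<union> B') \<in> R"
    and Pt: "\<And>q a. Pt q a \<in> W \<Longrightarrow> (l q a, l' q a) \<in> R"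
    and Base: "Base \<in> W"
    and Ap: "\<And>s i z. Ap s i z \<in> W \<Longrightarrow>
      z \<in> W \<and> src1 s \<in> W \<and> src2 s \<in> W \<and> tgt1 s \<in> W \<and> tgt2 s \<in> W \<and> (\<forall>w\<in>W. Ap s i w \<in> W)"
  shows "z \<in> W \<Longrightarrow> w \<in> W \<Longrightarrow> (dst l z w, dst l' z w) \<in> R"
proof -
  have gate: "gate z \<in> W" if "z \<in> W" for z
    using that by (induction z) (auto dest!: Ap simp: Base)
  have body: "body z \<in> W" if "z \<in> W" for z
  proof (cases z)
    case (Ap s i t)
    then show ?thesis using that assms(5)[of s i t] by simp
  qed (use that in simp_all)
  have hinge: "c \<in> W" if hinge: "hinge z w = Some c" and "z \<in> W" for z w c
    using hinge
  proof (rule hingeE)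
    fix s i j z' w'
    assume z: "z = Ap s i z'"
      and c: "i = 0 \<and> j = 1 \<and> c = src2 s \<or> i = 1 \<and> j = 0 \<and> c = src2 s \<or>
       i = 1 \<and> j = 2 \<and> c = src1 s \<or> i = 2 \<and> j = 1 \<and> c = src1 s"
    then show "c \<in> W" using that(2) Ap[of s i z'] by auto
  qed
  have "z \<in> W \<Longrightarrow> w \<in> W \<Longrightarrow> (dst l z w, dst l' z w) \<in> R"
    and "z \<in> W \<Longrightarrow> (lbl l z, lbl l' z) \<in> R" for z w
  proof (induction z w and z rule: gate_induct)
    case (1 k z w)
    consider "lev w < lev z" | "lev z < lev w" | "z = w" | "lev z = lev w" "z \<noteq> w" "same_copy z w"
      | c where "lev z = lev w" "z \<noteq> w" "\<not> same_copy z w" "hinge z w = Some c"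
      | "lev z = lev w" "z \<noteq> w" "\<not> same_copy z w" "hinge z w = None"
      by (metis linorder_neqE_nat not_Some_eq)
    then show ?case
    proof cases
      case c: 1
      have "(lbl l z, lbl l' z) \<in> R" "(dst l (gate z) w, dst l' (gate z) w) \<in> R"
        using 1(1,2)[OF c] 1(11,12) gate by blast+
      then show ?thesis using c un by (simp add: dst_high)
    next
      case c: 2
      then have "\<not> lev w < lev z" by simp
      note ih = 1(3,4)[OF this c]
      have "(lbl l w, lbl l' w) \<in> R" "(dst l z (gate w), dst l' z (gate w)) \<in> R"
        using ih 1(11,12) gate by blast+
      then show ?thesis using c un by (simp add: dst_high')
    next
      case 3
      then show ?thesis by (simp add: empty)
    next
      case c: 4
      have "body z \<in> W" "body w \<in> W"
        using 1(11,12) body by blast+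
      moreover have "\<not> lev w < lev z" "\<not> lev z < lev w" using c(1) by simp_all
      note 1(5)[OF this c(2,3)]
      ultimately show ?thesis using c by (simp add: dst_same_copy)
    next
      case h: (5 c)
      have "body z \<in> W" "body w \<in> W" "c \<in> W"
        using h(4) 1(11,12) body hinge by blast+
      moreover have "\<not> lev w < lev z" "\<not> lev z < lev w" using h(1) by simp_all
      note 1(9,10)[OF this h(2-4)]
      ultimately show ?thesis
        using un dst_hinge[OF h(1,4), of l] dst_hinge[OF h(1,4), of l'] by simp
    next
      case c: 6
      have "\<not> lev w < lev z" "\<not> lev z < lev w" using c(1) by simp_all
      note ih = 1(6-8)[OF this c(2-4)]
      have "(lbl l z, lbl l' z) \<in> R" "(lbl l w, lbl l' w) \<in> R"
        "(dst l (gate z) (gate w), dst l' (gate z) (gate w)) \<in> R"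
        using ih 1(11,12) gate by blast+
      then show ?thesis
        using un dst_generic[OF c, of l] dst_generic[OF c, of l'] by simp
    qed
  next
    case (5 k s i z)
    then show ?case using un Ap[of s i z] by simp
  qed (simp_all add: empty Pt)
  then show "z \<in> W \<Longrightarrow> w \<in> W \<Longrightarrow> (dst l z w, dst l' z w) \<in> R" by blast
qed

text \<open>This embeds the semilattice into a powerset and turns joins into unions.\<close>

definition not_above :: "('a, 'b) gorder_scheme \<Rightarrow> 'a \<Rightarrow> 'a set" where
  "not_above L a = {b \<in> carrier L. \<not> a \<sqsubseteq>\<^bsub>L\<^esub> b}"

context join_semilattice_zero
begin

lemma join_le_iff:
  assumes "a \<in> carrier L" "b \<in> carrier L" "c \<in> carrier L"
  shows "a \<squnion> b \<sqsubseteq> c \<longleftrightarrow> a \<sqsubseteq> c \<and> b \<sqsubseteq> c"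
  using assms join_le join_left join_right le_trans join_closed by meson

lemma le_iff_join_eq:
  assumes "a \<in> carrier L" "b \<in> carrier L"
  shows "a \<sqsubseteq> b \<longleftrightarrow> a \<squnion> b = b"
  using assms join_le_iff[of a b b] join_right[of a b] join_left[of a b] le_antisym[of "a \<squnion> b" b]
  by auto

lemma not_above_join:
  assumes "a \<in> carrier L" "b \<in> carrier L"
  shows "not_above L (a \<squnion> b) = not_above L a \<union> not_above L b"
  using assms by (auto simp: not_above_def join_le_iff)

lemma not_above_bottom: "not_above L \<bottom> = {}"
  by (auto simp: not_above_def)

lemma not_above_subset_iff:
  assumes "a \<in> carrier L" "b \<in> carrier L"
  shows "not_above L a \<subseteq> not_above L b \<longleftrightarrow> a \<sqsubseteq> b"
proof
  assume "not_above L a \<subseteq> not_above L b"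
  then have "b \<in> not_above L a \<Longrightarrow> b \<in> not_above L b" by blast
  then show "a \<sqsubseteq> b" using assms by (auto simp: not_above_def)
next
  assume "a \<sqsubseteq> b"
  then show "not_above L a \<subseteq> not_above L b"
    using assms le_trans by (auto simp: not_above_def)
qed

end

lemma jsz_hom_mono:
  assumes "join_semilattice_zero L" "join_semilattice_zero M" "jsz_hom L M f"
    and "a \<in> carrier L" "b \<in> carrier L" "a \<sqsubseteq>\<^bsub>L\<^esub> b"
  shows "f a \<sqsubseteq>\<^bsub>M\<^esub> f b"
proof -
  interpret L: join_semilattice_zero L by fact
  interpret M: join_semilattice_zero M by fact
  have "f a \<in> carrier M" "f b \<in> carrier M" "f (a \<squnion>\<^bsub>L\<^esub> b) = f a \<squnion>\<^bsub>M\<^esub> f b"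
    using assms by (auto simp: jsz_hom_def)
  then show ?thesis
    using assms L.le_iff_join_eq M.le_iff_join_eq by metis
qed

section \<open>Valid terms and their distances at each index\<close>

locale semilattice_diagram =
  fixes S :: "'p::order \<Rightarrow> 's gorder" and \<sigma> :: "'p \<Rightarrow> 'p \<Rightarrow> 's \<Rightarrow> 's"
  assumes diagram: "jsz_diagram S \<sigma>"
begin

lemma semilattice: "join_semilattice_zero (S p)"
  using diagram by (simp add: jsz_diagram_def)

lemma \<sigma>_hom: "p \<le> q \<Longrightarrow> jsz_hom (S p) (S q) (\<sigma> p q)"
  using diagram by (simp add: jsz_diagram_def)

lemma \<sigma>_closed: "p \<le> q \<Longrightarrow> a \<in> carrier (S p) \<Longrightarrow> \<sigma> p q a \<in> carrier (S q)"
  using \<sigma>_hom[of p q] by (auto simp: jsz_hom_def)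

lemma \<sigma>_id: "a \<in> carrier (S p) \<Longrightarrow> \<sigma> p p a = a"
  using diagram by (simp add: jsz_diagram_def)

lemma \<sigma>_comp:
  "p \<le> q \<Longrightarrow> q \<le> r \<Longrightarrow> a \<in> carrier (S p) \<Longrightarrow> \<sigma> q r (\<sigma> p q a) = \<sigma> p r a"
  using diagram unfolding jsz_diagram_def by blast

abbreviation up :: "'p \<Rightarrow> 's \<Rightarrow> 's set" where
  "up p \<equiv> not_above (S p)"

text \<open>A point adjoined at \<open>q\<close> carries at \<open>p\<close> the image of its label.
  Levels, gates and hinges are the same at all indices.\<close>

definition D :: "'p \<Rightarrow> ('p, 's) tm \<Rightarrow> ('p, 's) tm \<Rightarrow> 's set" where
  "D p = dst (\<lambda>q a. up p (\<sigma> q p a))"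

text \<open>The symbol is checked at its own index \<open>q\<close>, not at \<open>p\<close>, which
  makes validity persist upwards. As \<open>D\<close> is defined on all terms, validity and distance
  require no mutual recursion.\<close>

fun valid :: "'p \<Rightarrow> ('p, 's) tm \<Rightarrow> bool" where
  "valid p Base \<longleftrightarrow> True"
| "valid p (Pt q a) \<longleftrightarrow> q \<le> p \<and> a \<in> carrier (S q)"
| "valid p (Ap (Sym q x y u v) i z) \<longleftrightarrow> q \<le> p \<and> i < 3 \<and>
     valid q x \<and> valid q y \<and> valid q u \<and> valid q v \<and> D q u v \<subseteq> D q x y \<and> valid p z"
| "valid p _ \<longleftrightarrow> False"

lemma valid_Ap:
  "valid p (Ap s i z) \<longleftrightarrow> (\<exists>q x y u v. s = Sym q x y u v \<and> q \<le> p \<and> i < 3 \<and>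
     valid q x \<and> valid q y \<and> valid q u \<and> valid q v \<and> D q u v \<subseteq> D q x y \<and> valid p z)"
  by (cases s) auto

lemma valid_mono: "valid q z \<Longrightarrow> q \<le> p \<Longrightarrow> valid p z"
proof (induction z)
  case (Ap s i z)
  then show ?case unfolding valid_Ap using order.trans[of _ q p] by blast
qed auto

text \<open>Homomorphisms preserve zero and joins, and distances are built from labels by these
  alone.\<close>

lemma D_transfer:
  assumes "p \<le> q" "valid p z" "valid p w"
  obtains a where "a \<in> carrier (S p)" "D p z w = up p a" "D q z w = up q (\<sigma> p q a)"
proof -
  interpret P: join_semilattice_zero "S p" by (rule semilattice)
  interpret Q: join_semilattice_zero "S q" by (rule semilattice)
  note hom = \<sigma>_hom[OF assms(1), unfolded jsz_hom_def]
  \<comment> \<open>The graph of \<open>\<sigma> p q\<close>, with both coordinates embedded into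
    powersets.\<close>
  let ?R = "{(up p a, up q (\<sigma> p q a)) |a. a \<in> carrier (S p)}"
  have "(D p z w, D q z w) \<in> ?R"
    unfolding D_def
  proof (rule dst_related[where W = "{z. valid p z}"])
    show "({}, {}) \<in> ?R"
      using P.not_above_bottom Q.not_above_bottom hom by (metis (mono_tags, lifting) CollectI P.bottom_closed)
  next
    fix A B A' B'
    assume "(A, B) \<in> ?R" "(A', B') \<in> ?R"
    then obtain a a' where "a \<in> carrier (S p)" "A = up p a" "B = up q (\<sigma> p q a)"
      and "a' \<in> carrier (S p)" "A' = up p a'" "B' = up q (\<sigma> p q a')"
      by auto
    then have "A \<union> A' = up p (a \<squnion>\<^bsub>S p\<^esub> a')" "B \<union> B' = up q (\<sigma> p q (a \<squnion>\<^bsub>S p\<^esub> a'))"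
      "a \<squnion>\<^bsub>S p\<^esub> a' \<in> carrier (S p)"
      using hom assms(1) \<sigma>_closed by (simp_all add: P.not_above_join Q.not_above_join)
    then show "(A \<union> A', B \<union> B') \<in> ?R" by blast
  next
    fix r a
    assume "Pt r a \<in> {z. valid p z}"
    then show "(up p (\<sigma> r p a), up q (\<sigma> r q a)) \<in> ?R"
      using \<sigma>_comp[of r p q a] \<sigma>_closed[of r p a] assms(1) by auto
  next
    fix s i z
    assume "Ap s i z \<in> {z. valid p z}"
    then show "z \<in> {z. valid p z} \<and> src1 s \<in> {z. valid p z} \<and> src2 s \<in> {z. valid p z} \<and>
      tgt1 s \<in> {z. valid p z} \<and> tgt2 s \<in> {z. valid p z} \<and> (\<forall>w\<in>{z. valid p z}. Ap s i w \<in> {z. valid p z})"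
      using valid_mono by (auto simp: valid_Ap)
  qed (use assms in auto)
  then show ?thesis using that by auto
qed

lemma D_value:
  assumes "valid p z" "valid p w"
  obtains a where "a \<in> carrier (S p)" "D p z w = up p a"
  using D_transfer[OF order_refl assms] .

text \<open>Transition maps are monotone. Hence the condition under which an operation was adjoined
  persists at larger indices, and so does distance zero.\<close>

lemma D_mono:
  assumes "p \<le> q" "valid p z" "valid p w" "valid p z'" "valid p w'" "D p z w \<subseteq> D p z' w'"
  shows "D q z w \<subseteq> D q z' w'"
proof -
  interpret P: join_semilattice_zero "S p" by (rule semilattice)
  interpret Q: join_semilattice_zero "S q" by (rule semilattice)
  obtain a where a: "a \<in> carrier (S p)" "D p z w = up p a" "D q z w = up q (\<sigma> p q a)"
    using D_transfer[of p q z w] assms by blast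
  obtain b where b: "b \<in> carrier (S p)" "D p z' w' = up p b" "D q z' w' = up q (\<sigma> p q b)"
    using D_transfer[of p q z' w'] assms by blast
  have "a \<sqsubseteq>\<^bsub>S p\<^esub> b"
    using a b assms(6) P.not_above_subset_iff by simp
  then have "\<sigma> p q a \<sqsubseteq>\<^bsub>S q\<^esub> \<sigma> p q b"
    using jsz_hom_mono[OF semilattice semilattice \<sigma>_hom] a b assms(1) by blast
  then show ?thesis
    using a b \<sigma>_closed[OF assms(1)] Q.not_above_subset_iff by simp
qed

lemma term_space: "term_space (\<lambda>q a. up p (\<sigma> q p a)) {z. valid p z}"
proof
  fix s i z
  assume "Ap s i z \<in> {z. valid p z}"
  then obtain q x y u v where s: "s = Sym q x y u v" "q \<le> p" "i < 3"
     "valid q x" "valid q y" "valid q u" "valid q v" "D q u v \<subseteq> D q x y" and z: "valid p z"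
    by (auto simp: valid_Ap)
  then have "D p u v \<subseteq> D p x y" by (intro D_mono[of q p])
  with s z valid_mono show "z \<in> {z. valid p z} \<and> i < 3 \<and>
       (\<exists>q x y u v. s = Sym q x y u v \<and> x \<in> {z. valid p z} \<and> y \<in> {z. valid p z} \<and>
           u \<in> {z. valid p z} \<and> v \<in> {z. valid p z} \<and>
           dst (\<lambda>q a. up p (\<sigma> q p a)) u v \<subseteq> dst (\<lambda>q a. up p (\<sigma> q p a)) x y)"
    unfolding D_def by blast
qed (auto simp: valid_Ap)

lemma D_refl [simp]: "D p z z = {}"
  by (simp add: D_def)

lemma D_commute: "D p z w = D p w z"
  by (simp add: D_def dst_commute)

lemma D_triangle:
  "valid p z \<Longrightarrow> valid p w \<Longrightarrow> valid p y \<Longrightarrow> D p z y \<subseteq> D p z w \<union> D p w y"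
  using term_space.triangle[OF term_space] by (simp add: D_def)

lemma D_Ap [simp]: "D p (Ap s i z) (Ap s i w) = D p z w"
  by (simp add: D_def)

text \<open>\<open>Base\<close> and \<open>Pt p a\<close> are the canonical pair that will generate
  the congruence belonging to \<open>a\<close>.\<close>

lemma D_Base_Pt:
  assumes "a \<in> carrier (S p)"
  shows "D p Base (Pt p a) = up p a"
  using assms by (simp add: D_def dst_high' \<sigma>_id)

text \<open>Distinct points are joined through their common gate \<open>Base\<close>. This pair
  later yields the join of two generators.\<close>

lemma D_Pt_Pt:
  assumes "a \<in> carrier (S p)" "b \<in> carrier (S p)" "a \<noteq> b"
  shows "D p (Pt p a) (Pt p b) = up p a \<union> up p b"
  using assms by (simp add: D_def dst_generic \<sigma>_id)

text \<open>The equations imposed on the operations hold between terms only as zero distances; they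
  become equalities in the quotient.\<close>

lemma D_glue:
  fixes q x y u v
  defines "s \<equiv> Sym q x y u v"
  shows "D p (Ap s 0 x) u = {}" "D p (Ap s 0 y) (Ap s 1 y) = {}"
    "D p (Ap s 1 x) (Ap s 2 x) = {}" "D p (Ap s 2 y) v = {}"
proof -
  have lev: "lev x \<le> lev s" "lev y \<le> lev s" "lev u < Suc (lev s)" "lev v < Suc (lev s)"
    by (auto simp: s_def)
  show "D p (Ap s 0 x) u = {}" "D p (Ap s 2 y) v = {}"
    using lev by (simp_all add: D_def dst_high s_def less_max_iff_disj less_Suc_eq_le)
  have "src1 s = x" "src2 s = y" by (simp_all add: s_def)
  with lev have h: "hinge (Ap s 0 y) (Ap s 1 y) = Some y" "hinge (Ap s 1 x) (Ap s 2 x) = Some x"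
    by simp_all
  have "lev (Ap s 0 y) = lev (Ap s 1 y)" "lev (Ap s 1 x) = lev (Ap s 2 x)"
    by simp_all
  from dst_hinge[OF this(1) h(1)] dst_hinge[OF this(2) h(2)]
  show "D p (Ap s 0 y) (Ap s 1 y) = {}" "D p (Ap s 1 x) (Ap s 2 x) = {}"
    by (simp_all only: D_def body.simps dst_refl Un_empty_left)
qed

end

section \<open>The algebras\<close>

text \<open>Prefix notation, which places terms in the ambient type. The leading tag determines the
  constructor and so the number of arguments.\<close>

primrec enc :: "('p, 's) tm \<Rightarrow> ('p, 's) lift_symbol" where
  "enc Base = [Inl 0]"
| "enc (Pt q a) = [Inl 1, Inr (Inl q), Inr (Inr a)]"
| "enc (Sym q x y u v) = Inl 2 # Inr (Inl q) # enc x @ enc y @ enc u @ enc v"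
| "enc (Ap s i z) = Inl 3 # Inl i # enc s @ enc z"

text \<open>Unique readability; the arbitrary tails let the induction peel off concatenated
  arguments one by one.\<close>

lemma enc_append_eq: "enc z @ r = enc w @ r' \<Longrightarrow> z = w \<and> r = r'"
proof (induction z arbitrary: w r r')
  case (Sym q x y u v)
  show ?case
  proof (cases w)
    case w: (Sym q' x' y' u' v')
    have "enc x @ (enc y @ enc u @ enc v @ r) = enc x' @ (enc y' @ enc u' @ enc v' @ r')"
      and q: "q = q'"
      using Sym.prems w by simp_all
    note 1 = Sym.IH(1)[OF this(1)]
    note 2 = Sym.IH(2)[OF conjunct2[OF 1]]
    note 3 = Sym.IH(3)[OF conjunct2[OF 2]]
    note 4 = Sym.IH(4)[OF conjunct2[OF 3]]
    show ?thesis using 1 2 3 4 q w by blast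
  qed (use Sym.prems in auto)
next
  case (Ap s i z)
  show ?case
  proof (cases w)
    case w: (Ap s' i' z')
    have "enc s @ (enc z @ r) = enc s' @ (enc z' @ r')" and i: "i = i'"
      using Ap.prems w by simp_all
    note 1 = Ap.IH(1)[OF this(1)]
    note 2 = Ap.IH(2)[OF conjunct2[OF 1]]
    show ?thesis using 1 2 i w by blast
  qed (use Ap.prems in auto)
qed (case_tac w; simp)+

lemma inj_enc: "inj enc"
  using enc_append_eq[of _ "[]" _ "[]"] by (auto intro: injI)

lemma inv_enc [simp]: "inv enc (enc z) = z"
  by (simp add: inj_enc)

text \<open>An order isomorphism transports least upper bounds. Join and zero of \<open>M\<close>
  are choice terms, so the transported element must also be shown unique; this comes from
  antisymmetry in \<open>L\<close>.\<close>

lemma jsz_iso_inv_into: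
  assumes L: "join_semilattice_zero L" and bij: "bij_betw f (carrier L) (carrier M)"
    and le: "\<And>a b. a \<in> carrier L \<Longrightarrow> b \<in> carrier L \<Longrightarrow> f a \<sqsubseteq>\<^bsub>M\<^esub> f b \<longleftrightarrow> a \<sqsubseteq>\<^bsub>L\<^esub> b"
  shows "jsz_iso M L (inv_into (carrier L) f)"
proof -
  interpret L: join_semilattice_zero L by fact
  let ?g = "inv_into (carrier L) f"
  have M: "carrier M = f ` carrier L" using bij by (simp add: bij_betw_def)
  have g: "?g (f a) = a" if "a \<in> carrier L" for a
    using bij that by (simp add: bij_betw_def)
  have least: "least M x (Upper M (f ` A)) \<longleftrightarrow> (\<exists>a. least L a (Upper L A) \<and> x = f a)"
    if "A \<subseteq> carrier L" for A x
  proof -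
    have "Upper L A = {u \<in> carrier L. \<forall>x\<in>A. x \<sqsubseteq>\<^bsub>L\<^esub> u}"
      using that by (auto simp: Upper_def)
    moreover have "Upper M (f ` A) = {u \<in> carrier M. \<forall>x\<in>A. f x \<sqsubseteq>\<^bsub>M\<^esub> u}"
      using that M by (auto simp: Upper_def)
    moreover have "\<forall>x\<in>A. \<forall>u\<in>carrier L. f x \<sqsubseteq>\<^bsub>M\<^esub> f u \<longleftrightarrow> x \<sqsubseteq>\<^bsub>L\<^esub> u"
      using that le by blast
    ultimately have upper: "Upper M (f ` A) = f ` Upper L A"
      unfolding M by auto
    show ?thesis
    proof
      assume x: "least M x (Upper M (f ` A))"
      then obtain a where "a \<in> Upper L A" "x = f a"
        unfolding upper least_def by auto
      with x show "\<exists>a. least L a (Upper L A) \<and> x = f a"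
        using le unfolding upper least_def by (auto simp: Upper_def)
    next
      assume "\<exists>a. least L a (Upper L A) \<and> x = f a"
      then show "least M x (Upper M (f ` A))"
        using le unfolding upper least_def by (auto simp: M Upper_def)
    qed
  qed
  have unique: "a = b" if "least L a X" "least L b X" "X \<subseteq> carrier L" for a b X
    using that L.le_antisym unfolding least_def by blast
  have join: "f a \<squnion>\<^bsub>M\<^esub> f b = f (a \<squnion>\<^bsub>L\<^esub> b)" if ab: "a \<in> carrier L" "b \<in> carrier L" for a b
  proof -
    have ab': "least L (a \<squnion>\<^bsub>L\<^esub> b) (Upper L {a, b})"
      using ab L.sup_of_two_least by (simp add: join_def)
    show ?thesis
      unfolding join_def[of M] sup_def
    proof (rule some_equality)
      show "least M (f (a \<squnion>\<^bsub>L\<^esub> b)) (Upper M {f a, f b})"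
        using ab ab' least[of "{a, b}"] by auto
    next
      fix x
      assume "least M x (Upper M {f a, f b})"
      then obtain c where c: "least L c (Upper L {a, b})" "x = f c"
        using ab least[of "{a, b}" x] by auto
      then show "x = f (a \<squnion>\<^bsub>L\<^esub> b)"
        using unique[OF c(1) ab'] by simp
    qed
  qed
  have bot: "\<bottom>\<^bsub>M\<^esub> = f \<bottom>\<^bsub>L\<^esub>"
    unfolding bottom_def[of M]
  proof (rule some_equality)
    show "least M (f \<bottom>\<^bsub>L\<^esub>) (carrier M)"
      using le L.bottom_least unfolding least_def by (auto simp: M)
  next
    fix x
    assume x: "least M x (carrier M)"
    then obtain a where a: "a \<in> carrier L" "x = f a" unfolding least_def M by auto
    with x le have "least L a (carrier L)" unfolding least_def M by auto
    then show "x = f \<bottom>\<^bsub>L\<^esub>" using a unique[OF _ L.bottom_least] by auto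
  qed
  show ?thesis
    unfolding jsz_iso_def jsz_hom_def
    using bij_betw_inv_into[OF bij] by (auto simp: M join g bot)
qed

section \<open>Quotient algebras, transition maps and their congruences\<close>

context semilattice_diagram
begin

text \<open>The class of \<open>z\<close> modulo distance zero, as a set of words to fit the ambient
  type.\<close>

definition cls :: "'p \<Rightarrow> ('p, 's) tm \<Rightarrow> ('p, 's) lift_element" where
  "cls p z = enc ` {w. valid p w \<and> D p z w = {}}"

definition rep :: "'p \<Rightarrow> ('p, 's) lift_element \<Rightarrow> ('p, 's) tm" where
  "rep p X = (SOME z. valid p z \<and> X = cls p z)"

text \<open>An operation is named by the word of its value at \<open>Base\<close>, so it is in the
  language exactly when that term is valid. The default branch is never reached by a symbol of the
  language.\<close>

definition B :: "'p \<Rightarrow> (('p, 's) lift_symbol, ('p, 's) lift_element) unary_algebra" where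
  "B p = \<lparr>lang = {enc (Ap s i Base) |s i. valid p (Ap s i Base)},
     universe = cls p ` {z. valid p z},
     opn = \<lambda>f X. case inv enc f of Ap s i _ \<Rightarrow> cls p (Ap s i (rep p X)) | _ \<Rightarrow> X\<rparr>"

definition tr :: "'p \<Rightarrow> 'p \<Rightarrow> ('p, 's) lift_element \<Rightarrow> ('p, 's) lift_element" where
  "tr p q X = cls q (rep p X)"

definition \<Theta> :: "'p \<Rightarrow> 's set \<Rightarrow> (('p, 's) lift_element \<times> ('p, 's) lift_element) set" where
  "\<Theta> p E = {(cls p z, cls p w) |z w. valid p z \<and> valid p w \<and> D p z w \<subseteq> E}"

lemma D_cong:
  assumes "valid p z" "valid p z'" "valid p w" "valid p w'" "D p z z' = {}" "D p w w' = {}"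
  shows "D p z w = D p z' w'"
  using assms D_triangle[of p z z' w] D_triangle[of p z' w' w] D_triangle[of p z' z w']
    D_triangle[of p z w w'] D_commute[of p z z'] D_commute[of p w w'] by auto

lemma cls_eq_iff:
  assumes "valid p z" "valid p w"
  shows "cls p z = cls p w \<longleftrightarrow> D p z w = {}"
proof
  assume "cls p z = cls p w"
  moreover have "enc w \<in> cls p w" using assms by (simp add: cls_def)
  ultimately have "enc w \<in> cls p z" by simp
  then show "D p z w = {}" by (simp add: cls_def inj_image_mem_iff[OF inj_enc])
next
  assume zw: "D p z w = {}"
  have "D p z y = D p w y" if "valid p y" for y
    using assms that zw by (intro D_cong) auto
  then show "cls p z = cls p w" by (auto simp: cls_def)
qed

lemma rep_cls:
  assumes "valid p z"
  shows "valid p (rep p (cls p z))" "D p z (rep p (cls p z)) = {}"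
proof -
  have "valid p (rep p (cls p z)) \<and> cls p z = cls p (rep p (cls p z))"
    unfolding rep_def by (rule someI[of _ z]) (use assms in simp)
  then show "valid p (rep p (cls p z))" "D p z (rep p (cls p z)) = {}"
    using assms cls_eq_iff by auto
qed

lemma in_universe: "valid p z \<Longrightarrow> cls p z \<in> universe (B p)"
  by (simp add: B_def)

lemma universeE:
  assumes "X \<in> universe (B p)"
  obtains z where "valid p z" "X = cls p z"
  using assms by (auto simp: B_def)

lemma langE:
  assumes "f \<in> lang (B p)"
  obtains s i where "f = enc (Ap s i Base)" "valid p (Ap s i Base)"
  using assms by (auto simp: B_def)

lemma valid_ApI: "valid p (Ap s i Base) \<Longrightarrow> valid p z \<Longrightarrow> valid p (Ap s i z)"
  by (auto simp: valid_Ap)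

text \<open>Operations are isometries, so the chosen representative does not affect the class of the
  value.\<close>

lemma opn_cls:
  assumes "valid p (Ap s i Base)" "valid p z"
  shows "opn (B p) (enc (Ap s i Base)) (cls p z) = cls p (Ap s i z)"
proof -
  have "opn (B p) (enc (Ap s i Base)) (cls p z) = cls p (Ap s i (rep p (cls p z)))"
    by (simp add: B_def del: enc.simps)
  also have "\<dots> = cls p (Ap s i z)"
    using assms rep_cls[OF assms(2)] by (simp add: cls_eq_iff valid_ApI D_commute[of p _ z])
  finally show ?thesis .
qed

lemma tr_cls:
  assumes "p \<le> q" "valid p z"
  shows "tr p q (cls p z) = cls q z"
proof -
  let ?r = "rep p (cls p z)"
  note r = rep_cls[OF assms(2)]
  \<comment> \<open>Writing distance zero as an inclusion in \<open>D q z z\<close> makes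
    monotonicity along the diagram applicable.\<close>
  have "D q z ?r \<subseteq> D q z z"
    by (rule D_mono[of p]) (use assms r in auto)
  then show ?thesis
    using assms r by (simp add: tr_def cls_eq_iff valid_mono D_commute[of q ?r])
qed

lemma algebra: "is_unary_algebra (B p)"
proof -
  have "cls p Base \<in> universe (B p)" by (simp add: in_universe)
  moreover have "opn (B p) f X \<in> universe (B p)" if "f \<in> lang (B p)" "X \<in> universe (B p)" for f X
    using that by (elim langE universeE) (simp add: opn_cls in_universe valid_ApI del: enc.simps)
  ultimately show ?thesis unfolding is_unary_algebra_def by auto
qed

lemma malg_diagram: "malg_diagram B tr"
proof -
  have hom: "malg_hom (B p) (B q) (tr p q)" if pq: "p \<le> q" for p q
  proof -
    have lang: "lang (B p) \<subseteq> lang (B q)"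
      using valid_mono[OF _ pq] by (auto simp: B_def)
    have "tr p q X \<in> universe (B q)" if "X \<in> universe (B p)" for X
      using that pq by (elim universeE) (simp add: tr_cls in_universe valid_mono)
    moreover have "tr p q (opn (B p) f X) = opn (B q) f (tr p q X)"
      if "f \<in> lang (B p)" "X \<in> universe (B p)" for f X
      using that
    proof (elim langE universeE)
      fix s i z
      assume "f = enc (Ap s i Base)" "valid p (Ap s i Base)" "valid p z" "X = cls p z"
      moreover from this have "valid q (Ap s i Base)" "valid q z"
        using valid_mono pq by blast+
      ultimately show ?thesis
        using pq by (simp add: opn_cls tr_cls valid_ApI del: enc.simps)
    qed
    ultimately show ?thesis using lang by (auto simp: malg_hom_def)
  qed
  have id: "tr p p X = X" if "X \<in> universe (B p)" for p X
    using that by (elim universeE) (simp add: tr_cls)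
  have comp: "tr q r (tr p q X) = tr p r X" if "p \<le> q" "q \<le> r" "X \<in> universe (B p)" for p q r X
    using that by (elim universeE) (simp add: tr_cls valid_mono order.trans[of p q r])
  show ?thesis
    by (simp add: malg_diagram_def hom algebra id comp)
qed

lemma \<Theta>_iff:
  assumes "valid p z" "valid p w"
  shows "(cls p z, cls p w) \<in> \<Theta> p E \<longleftrightarrow> D p z w \<subseteq> E"
proof
  assume "(cls p z, cls p w) \<in> \<Theta> p E"
  then obtain z' w' where "cls p z = cls p z'" "cls p w = cls p w'" "valid p z'" "valid p w'"
    "D p z' w' \<subseteq> E"
    by (auto simp: \<Theta>_def)
  then show "D p z w \<subseteq> E" using assms D_cong[of p z z' w w'] by (simp add: cls_eq_iff)
qed (use assms in \<open>auto simp: \<Theta>_def\<close>)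

lemma \<Theta>_subset: "\<Theta> p E \<subseteq> universe (B p) \<times> universe (B p)"
  by (auto simp: \<Theta>_def in_universe)

text \<open>Transitivity is the triangle inequality, and compatibility with the operations is their
  isometry.\<close>

lemma congruence_\<Theta>: "congruence_of (B p) (\<Theta> p E)"
proof -
  have "refl_on (universe (B p)) (\<Theta> p E)"
    by (rule refl_onI) (auto elim!: universeE simp: \<Theta>_iff)
  moreover have "sym (\<Theta> p E)"
  proof (rule symI)
    fix X Y
    assume "(X, Y) \<in> \<Theta> p E"
    then obtain z w where "X = cls p z" "Y = cls p w" "valid p z" "valid p w" "D p z w \<subseteq> E"
      by (auto simp: \<Theta>_def)
    then show "(Y, X) \<in> \<Theta> p E" by (simp add: \<Theta>_iff D_commute[of p w z])
  qed
  moreover have "trans (\<Theta> p E)"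
  proof (rule transI)
    fix X Y Z
    assume XY: "(X, Y) \<in> \<Theta> p E" and YZ: "(Y, Z) \<in> \<Theta> p E"
    then have "X \<in> universe (B p)" "Y \<in> universe (B p)" "Z \<in> universe (B p)"
      using \<Theta>_subset by blast+
    then obtain x y z where v: "valid p x" "valid p y" "valid p z"
      and "X = cls p x" "Y = cls p y" "Z = cls p z"
      by (auto elim!: universeE)
    then show "(X, Z) \<in> \<Theta> p E"
      using XY YZ D_triangle[OF v] by (auto simp: \<Theta>_iff)
  qed
  ultimately have "equiv (universe (B p)) (\<Theta> p E)"
    using \<Theta>_subset by (intro equivI)
  moreover have "(opn (B p) f X, opn (B p) f Y) \<in> \<Theta> p E"
    if f: "f \<in> lang (B p)" and XY: "(X, Y) \<in> \<Theta> p E" for f X Y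
  proof -
    obtain z w where "valid p z" "valid p w" "X = cls p z" "Y = cls p w"
      using XY by (auto simp: \<Theta>_def)
    with f XY show ?thesis
      by (elim langE) (simp add: opn_cls \<Theta>_iff valid_ApI del: enc.simps)
  qed
  ultimately show ?thesis unfolding congruence_of_def by blast
qed

text \<open>The operations adjoined at \<open>p\<close> for \<open>x\<close>, \<open>y\<close>,
  \<open>u\<close>, \<open>v\<close> give a chain from \<open>u\<close> to \<open>v\<close>:
  \<open>f\<^sub>0\<close> carries \<open>x\<close> to \<open>y\<close>, \<open>f\<^sub>1\<close> is
  run backwards from \<open>y\<close> to \<open>x\<close>, \<open>f\<^sub>2\<close> again forwards,
  and the ends match by the gluing.\<close>

lemma congruence_closed:
  assumes \<theta>: "congruence_of (B p) \<theta>" and xy: "(cls p x, cls p y) \<in> \<theta>"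
    and valid: "valid p x" "valid p y" "valid p u" "valid p v" and le: "D p u v \<subseteq> D p x y"
  shows "(cls p u, cls p v) \<in> \<theta>"
proof -
  define s where "s = Sym p x y u v"
  have vB: "valid p (Ap s i Base)" if "i < 3" for i
    using that valid le by (simp add: s_def)
  then have v: "valid p (Ap s i z)" if "i < 3" "valid p z" for i z
    using that valid_ApI by blast
  have step: "(cls p (Ap s i x), cls p (Ap s i y)) \<in> \<theta>" if "i < 3" for i
  proof -
    have "enc (Ap s i Base) \<in> lang (B p)"
      using vB[OF that] by (auto simp: B_def)
    with \<theta> xy have "(opn (B p) (enc (Ap s i Base)) (cls p x), opn (B p) (enc (Ap s i Base)) (cls p y)) \<in> \<theta>"
      unfolding congruence_of_def by blast
    then show ?thesis using vB[OF that] valid by (simp add: opn_cls del: enc.simps)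
  qed
  have eqv: "equiv (universe (B p)) \<theta>" using \<theta> by (simp add: congruence_of_def)
  have sym: "(Y, X) \<in> \<theta>" if "(X, Y) \<in> \<theta>" for X Y
    using eqv that by (meson equivE symE)
  have trans: "(X, Z) \<in> \<theta>" if "(X, Y) \<in> \<theta>" "(Y, Z) \<in> \<theta>" for X Y Z
    using eqv that by (meson equivE transE)
  have glue: "cls p (Ap s 0 x) = cls p u" "cls p (Ap s 0 y) = cls p (Ap s 1 y)"
    "cls p (Ap s 1 x) = cls p (Ap s 2 x)" "cls p (Ap s 2 y) = cls p v"
    using D_glue[of p, where q = p and x = x and y = y and u = u and v = v, folded s_def] v valid
    by (simp_all add: cls_eq_iff)
  have "(cls p u, cls p (Ap s 1 y)) \<in> \<theta>"
    using step[of 0] glue(1,2) by simp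
  moreover have "(cls p (Ap s 1 y), cls p (Ap s 2 x)) \<in> \<theta>"
    using sym[OF step[of 1]] glue(3) by simp
  moreover have "(cls p (Ap s 2 x), cls p v) \<in> \<theta>"
    using step[of 2] glue(4) by simp
  ultimately show ?thesis by (blast intro: trans)
qed

text \<open>The element \<open>a\<close> is the join of the distances of the pairs in
  \<open>X\<close>; the single pair \<open>Base\<close>, \<open>Pt p a\<close> then generates the
  same congruence as \<open>X\<close>.\<close>

lemma finite_congruence:
  assumes "finite X" "X \<subseteq> universe (B p) \<times> universe (B p)"
  shows "\<exists>a\<in>carrier (S p). X \<subseteq> \<Theta> p (up p a) \<and>
    (\<forall>\<theta>. congruence_of (B p) \<theta> \<and> X \<subseteq> \<theta> \<longrightarrow> (cls p Base, cls p (Pt p a)) \<in> \<theta>)"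
  using assms
proof (induction X)
  case empty
  interpret join_semilattice_zero "S p" by (rule semilattice)
  have "cls p Base = cls p (Pt p \<bottom>\<^bsub>S p\<^esub>)"
    by (simp add: cls_eq_iff D_Base_Pt not_above_bottom)
  moreover have "(cls p Base, cls p Base) \<in> \<theta>" if "congruence_of (B p) \<theta>" for \<theta>
    using that in_universe[of p Base] by (auto simp: congruence_of_def equiv_def refl_on_def)
  ultimately show ?case by (intro bexI[of _ "\<bottom>\<^bsub>S p\<^esub>"]) auto
next
  case (insert e X)
  interpret join_semilattice_zero "S p" by (rule semilattice)
  obtain a where a: "a \<in> carrier (S p)" "X \<subseteq> \<Theta> p (up p a)"
    "\<And>\<theta>. congruence_of (B p) \<theta> \<Longrightarrow> X \<subseteq> \<theta> \<Longrightarrow> (cls p Base, cls p (Pt p a)) \<in> \<theta>"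
    using insert by auto
  obtain z w where e: "e = (cls p z, cls p w)" and v: "valid p z" "valid p w"
    using insert.prems by (auto elim!: universeE)
  obtain b where b: "b \<in> carrier (S p)" "D p z w = up p b"
    using D_value[OF v] .
  let ?c = "a \<squnion>\<^bsub>S p\<^esub> b"
  have c: "?c \<in> carrier (S p)" "up p ?c = up p a \<union> up p b"
    using a b by (simp_all add: not_above_join)
  have "insert e X \<subseteq> \<Theta> p (up p ?c)"
  proof -
    have "\<Theta> p (up p a) \<subseteq> \<Theta> p (up p ?c)" unfolding \<Theta>_def c(2) by blast
    moreover have "e \<in> \<Theta> p (up p ?c)" using b v by (simp add: e \<Theta>_iff c(2))
    ultimately show ?thesis using a(2) by blast
  qed
  moreover have "(cls p Base, cls p (Pt p ?c)) \<in> \<theta>"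
    if \<theta>: "congruence_of (B p) \<theta>" and "insert e X \<subseteq> \<theta>" for \<theta>
  proof -
    have vp: "valid p (Pt p a)" "valid p (Pt p b)" "valid p (Pt p ?c)"
      using a b c by simp_all
    have A: "(cls p Base, cls p (Pt p a)) \<in> \<theta>" using that a by blast
    \<comment> \<open>If \<open>a = b\<close>, the two points are one term at distance zero from
      itself, so the pair of points cannot produce the join; \<open>Pt p a\<close> already
      does.\<close>
    show ?thesis
    proof (cases "a = b")
      case True
      then show ?thesis
        using congruence_closed[OF \<theta> A] vp a b c by (simp add: D_Base_Pt)
    next
      case False
      have "(cls p z, cls p w) \<in> \<theta>" using that e by blast
      then have Bb: "(cls p Base, cls p (Pt p b)) \<in> \<theta>"
        using congruence_closed[OF \<theta>, of z w Base "Pt p b"] v vp b by (simp add: D_Base_Pt)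
      have "equiv (universe (B p)) \<theta>" using \<theta> by (simp add: congruence_of_def)
      with A Bb have "(cls p (Pt p a), cls p (Pt p b)) \<in> \<theta>"
        by (meson equivE symE transE)
      then show ?thesis
        using congruence_closed[OF \<theta>, of "Pt p a" "Pt p b" Base "Pt p ?c"] vp a b c False
        by (simp add: D_Base_Pt D_Pt_Pt)
    qed
  qed
  ultimately show ?case using c(1) by blast
qed

text \<open>The canonical pair has distance exactly \<open>up p a\<close>, so a congruence
  containing it contains every pair within that distance.\<close>

lemma Cg_eq_\<Theta>:
  assumes "a \<in> carrier (S p)" "X \<subseteq> \<Theta> p (up p a)"
    and "\<And>\<theta>. congruence_of (B p) \<theta> \<Longrightarrow> X \<subseteq> \<theta> \<Longrightarrow> (cls p Base, cls p (Pt p a)) \<in> \<theta>"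
  shows "Cg (B p) X = \<Theta> p (up p a)"
proof
  show "Cg (B p) X \<subseteq> \<Theta> p (up p a)"
    using assms congruence_\<Theta> unfolding Cg_def by blast
  have "\<Theta> p (up p a) \<subseteq> \<theta>" if "congruence_of (B p) \<theta>" "X \<subseteq> \<theta>" for \<theta>
  proof -
    have "(cls p z, cls p w) \<in> \<theta>" if "valid p z" "valid p w" "D p z w \<subseteq> up p a" for z w
      using congruence_closed[OF _ assms(3), of \<theta> z w] that \<open>congruence_of (B p) \<theta>\<close> \<open>X \<subseteq> \<theta>\<close> assms(1)
      by (simp add: D_Base_Pt)
    then show ?thesis unfolding \<Theta>_def by blast
  qed
  then show "\<Theta> p (up p a) \<subseteq> Cg (B p) X"
    unfolding Cg_def by blast
qed

lemma \<Theta>_Base_Pt: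
  assumes "a \<in> carrier (S p)"
  shows "(cls p Base, cls p (Pt p a)) \<in> \<Theta> p (up p a)"
  using assms by (simp add: \<Theta>_iff D_Base_Pt)

lemma compact_congruences_eq:
  "compact_congruences (B p) = (\<lambda>a. \<Theta> p (up p a)) ` carrier (S p)"
proof (intro equalityI subsetI)
  fix \<alpha>
  assume "\<alpha> \<in> compact_congruences (B p)"
  then obtain X where "\<alpha> = Cg (B p) X" "finite X" "X \<subseteq> universe (B p) \<times> universe (B p)"
    by (auto simp: compact_congruences_def)
  with finite_congruence[of X p] Cg_eq_\<Theta> show "\<alpha> \<in> (\<lambda>a. \<Theta> p (up p a)) ` carrier (S p)"
    by blast
next
  fix \<alpha>
  assume "\<alpha> \<in> (\<lambda>a. \<Theta> p (up p a)) ` carrier (S p)"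
  then obtain a where a: "a \<in> carrier (S p)" "\<alpha> = \<Theta> p (up p a)" by blast
  then have "\<alpha> = Cg (B p) {(cls p Base, cls p (Pt p a))}"
    using \<Theta>_Base_Pt by (intro Cg_eq_\<Theta>[symmetric, THEN trans[rotated]]) auto
  then show "\<alpha> \<in> compact_congruences (B p)"
    using a by (auto simp: compact_congruences_def in_universe)
qed

lemma \<Theta>_subset_iff:
  assumes "a \<in> carrier (S p)" "b \<in> carrier (S p)"
  shows "\<Theta> p (up p a) \<subseteq> \<Theta> p (up p b) \<longleftrightarrow> a \<sqsubseteq>\<^bsub>S p\<^esub> b"
proof -
  interpret join_semilattice_zero "S p" by (rule semilattice)
  have "\<Theta> p (up p a) \<subseteq> \<Theta> p (up p b) \<longleftrightarrow> up p a \<subseteq> up p b"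
  proof
    assume "\<Theta> p (up p a) \<subseteq> \<Theta> p (up p b)"
    then have "(cls p Base, cls p (Pt p a)) \<in> \<Theta> p (up p b)"
      using \<Theta>_Base_Pt[OF assms(1)] by blast
    then show "up p a \<subseteq> up p b" using assms by (simp add: \<Theta>_iff D_Base_Pt)
  qed (auto simp: \<Theta>_def)
  then show ?thesis using assms not_above_subset_iff by simp
qed

text \<open>Naturality: read at \<open>q\<close>, the point \<open>Pt p a\<close> has the same
  distance from \<open>Base\<close> as \<open>Pt q (\<sigma> p q a)\<close>, so the image of one
  canonical pair generates the other.\<close>

lemma Conc_map_\<Theta>:
  assumes "p \<le> q" "a \<in> carrier (S p)"
  shows "Conc_map (B q) (tr p q) (\<Theta> p (up p a)) = \<Theta> q (up q (\<sigma> p q a))"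
  unfolding Conc_map_def
proof (rule Cg_eq_\<Theta>)
  let ?X = "{(tr p q X, tr p q Y) |X Y. (X, Y) \<in> \<Theta> p (up p a)}"
  have Pt: "D q Base (Pt p a) = up q (\<sigma> p q a)"
    by (simp add: D_def dst_high')
  show "\<sigma> p q a \<in> carrier (S q)" using assms \<sigma>_closed by blast
  show "?X \<subseteq> \<Theta> q (up q (\<sigma> p q a))"
  proof clarify
    fix X Y
    assume "(X, Y) \<in> \<Theta> p (up p a)"
    then obtain z w where zw: "X = cls p z" "Y = cls p w" "valid p z" "valid p w" "D p z w \<subseteq> up p a"
      by (auto simp: \<Theta>_def)
    then have "D q z w \<subseteq> D q Base (Pt p a)"
      using assms by (intro D_mono[of p q]) (simp_all add: D_Base_Pt)
    then show "(tr p q X, tr p q Y) \<in> \<Theta> q (up q (\<sigma> p q a))"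
      using zw assms by (simp add: tr_cls \<Theta>_iff valid_mono Pt)
  qed
  fix \<theta>
  assume \<theta>: "congruence_of (B q) \<theta>" and "?X \<subseteq> \<theta>"
  then have "(tr p q (cls p Base), tr p q (cls p (Pt p a))) \<in> \<theta>"
    using \<Theta>_Base_Pt[OF assms(2)] by blast
  then have "(cls q Base, cls q (Pt p a)) \<in> \<theta>"
    using assms by (simp add: tr_cls)
  then show "(cls q Base, cls q (Pt q (\<sigma> p q a))) \<in> \<theta>"
    using congruence_closed[OF \<theta>, of Base "Pt p a" Base "Pt q (\<sigma> p q a)"] assms \<sigma>_closed
    by (simp add: D_Base_Pt Pt)
qed

text \<open>The map from \<open>a\<close> to \<open>\<Theta> p (up p a)\<close> is an order
  isomorphism onto the compact congruences; its inverse points in the required direction.\<close>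

lemma lifting:
  "jsz_diagram_iso (\<lambda>p. Conc (B p)) (\<lambda>p q. Conc_map (B q) (tr p q)) S \<sigma>
     (\<lambda>p. inv_into (carrier (S p)) (\<lambda>a. \<Theta> p (up p a)))"
proof -
  have inj: "inj_on (\<lambda>a. \<Theta> p (up p a)) (carrier (S p))" for p
  proof -
    interpret join_semilattice_zero "S p" by (rule semilattice)
    show ?thesis
    proof (rule inj_onI)
      fix a b
      assume "a \<in> carrier (S p)" "b \<in> carrier (S p)" "\<Theta> p (up p a) = \<Theta> p (up p b)"
      then show "a = b"
        using \<Theta>_subset_iff[of a p b] \<Theta>_subset_iff[of b p a] le_antisym by simp
    qed
  qed
  show ?thesis
    unfolding jsz_diagram_iso_def
  proof (intro conjI allI impI ballI)
    fix p
    show "jsz_iso (Conc (B p)) (S p) (inv_into (carrier (S p)) (\<lambda>a. \<Theta> p (up p a)))"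
      by (rule jsz_iso_inv_into[OF semilattice])
        (use inj in \<open>auto simp: Conc_def compact_congruences_eq bij_betw_def \<Theta>_subset_iff\<close>)
  next
    fix p q \<alpha>
    assume "p \<le> q" "\<alpha> \<in> carrier (Conc (B p))"
    then obtain a where "a \<in> carrier (S p)" "\<alpha> = \<Theta> p (up p a)"
      by (auto simp: Conc_def compact_congruences_eq)
    with \<open>p \<le> q\<close> show "inv_into (carrier (S q)) (\<lambda>a. \<Theta> q (up q a)) (Conc_map (B q) (tr p q) \<alpha>) =
        \<sigma> p q (inv_into (carrier (S p)) (\<lambda>a. \<Theta> p (up p a)) \<alpha>)"
      using inv_into_f_f[OF inj] \<sigma>_closed by (simp add: Conc_map_\<Theta>)
  qed
qed

end

theorem mainTheorem4:
  fixes S :: "'p::order \<Rightarrow> 's gorder"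
    and \<sigma> :: "'p \<Rightarrow> 'p \<Rightarrow> 's \<Rightarrow> 's"
  assumes "jsz_diagram S \<sigma>"
    and "finite (UNIV :: 'p set) \<or>
      (\<exists>(\<kappa> :: 'k rel) (\<mu> :: 'l rel).
         Card_order \<kappa> \<and> Cinfinite \<mu> \<and> regularCard \<mu> \<and>
         |UNIV :: 'p set| <o \<mu> \<and> (\<forall>p. |carrier (S p)| <o \<mu>) \<and>
         arrow \<kappa> \<mu> \<mu>)"
  shows "\<exists>(B :: 'p \<Rightarrow> (('p, 's) lift_symbol, ('p, 's) lift_element) unary_algebra) h \<epsilon>.
    malg_diagram B h \<and>
    jsz_diagram_iso (\<lambda>p. Conc (B p)) (\<lambda>p q. Conc_map (B q) (h p q)) S \<sigma> \<epsilon>"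
proof -
  interpret semilattice_diagram S \<sigma>
    using assms(1) by unfold_locales
  show ?thesis using malg_diagram lifting by blast
qed

end
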